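(* (i) For every set $X$, the inclusion $Q(\mathbf{F}_3(X)) \subseteq \mathsf{Pa}^-_3$ is proper, i.e. $Q(\mathbf{F}_3(X)) \subsetneq \mathsf{Pa}^-_3$. (ii) The quasivariety $\operatorname{Mod}(\mathbf{qb}_3)$ is not generated by free $p$-algebras, i.e. there is no class $\mathcal{K}$ of free $p$-algebras such that $Q(\mathcal{K}) = \operatorname{Mod}(\mathbf{qb}_3)$.
   Context: A (distributive) $p$-algebra is an algebra $(A,\wedge,\vee,{}^*,0,1)$ such that $(A,\wedge,\vee,0,1)$ is a bounded distributive lattice and $x^*$ is the pseudocomplement of $x$, i.e. $y\le x^*$ iff $x\wedge y=0$. Homomorphisms, subalgebras, products, embeddings (injective homomorphisms) and (quasi)varieties are taken in the signature $\wedge,\vee,{}^*,0,1$. For $n\ge 0$, $\bar{\mathbf{B}}_n$ is the $p$-algebra obtained from the Boolean lattice $2^n$ by adjoining a new top element $1$ (so $0^*=1$, $1^*=0$, and for $x\in 2^n\setminus\{0\}$ the element $x^*$ is the complement of $x$ in $2^n$). $\mathsf{Pa}_n=V(\bar{\mathbf{B}}_n)$ is the variety generated by $\bar{\mathbf{B}}_n$. $\mathbf{F}_n(X)$ denotes the free algebra in $\mathsf{Pa}_n$ freely generated by the set $X$. A free $p$-algebra is an algebra that is free (over some set of generators) in some variety of $p$-algebras; this includes all $\mathbf{F}_n(X)$ as well as the free algebras in the variety of all $p$-algebras. For a class $\mathcal{K}$ of $p$-algebras, $Q(\mathcal{K})$ is the smallest quasivariety containing $\mathcal{K}$, and $Q(\mathbf{A})=Q(\{\mathbf{A}\})$.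 $\mathbf{qb}_3$ is a quasi-identity in the language of $p$-algebras such that a $p$-algebra $\mathbf{A}$ satisfies $\mathbf{qb}_3$ if and only if $\bar{\mathbf{B}}_3$ does not embed into $\mathbf{A}$; thus $\operatorname{Mod}(\mathbf{qb}_3)$ is the class of all $p$-algebras into which $\bar{\mathbf{B}}_3$ does not embed. Finally $\mathsf{Pa}^-_3=\mathsf{Pa}_3\cap\operatorname{Mod}(\mathbf{qb}_3)$. *)

theory Defs
  imports "HOL-Library.Infinite_Typeclass"
begin

section \<open>Distributive p-algebras\<close>

record 'a palg =
  carrier :: "'a set"
  meet :: "'a \<Rightarrow> 'a \<Rightarrow> 'a"
  join :: "'a \<Rightarrow> 'a \<Rightarrow> 'a"
  star :: "'a \<Rightarrow> 'a"
  pbot :: 'a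
  ptop :: 'a

locale p_algebra =
  fixes A :: "'a palg"
  assumes bot_closed: "pbot A \<in> carrier A"
    and top_closed: "ptop A \<in> carrier A"
    and star_closed: "x \<in> carrier A \<Longrightarrow> star A x \<in> carrier A"
    and meet_closed: "x \<in> carrier A \<Longrightarrow> y \<in> carrier A \<Longrightarrow> meet A x y \<in> carrier A"
    and join_closed: "x \<in> carrier A \<Longrightarrow> y \<in> carrier A \<Longrightarrow> join A x y \<in> carrier A"
    and meet_comm: "x \<in> carrier A \<Longrightarrow> y \<in> carrier A \<Longrightarrow> meet A x y = meet A y x"
    and join_comm: "x \<in> carrier A \<Longrightarrow> y \<in> carrier A \<Longrightarrow> join A x y = join A y x"
    and meet_assoc: "x \<in> carrier A \<Longrightarrow> y \<in> carrier A \<Longrightarrow> z \<in> carrier A \<Longrightarrow>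
      meet A (meet A x y) z = meet A x (meet A y z)"
    and join_assoc: "x \<in> carrier A \<Longrightarrow> y \<in> carrier A \<Longrightarrow> z \<in> carrier A \<Longrightarrow>
      join A (join A x y) z = join A x (join A y z)"
    and meet_absorb: "x \<in> carrier A \<Longrightarrow> y \<in> carrier A \<Longrightarrow> meet A x (join A x y) = x"
    and join_absorb: "x \<in> carrier A \<Longrightarrow> y \<in> carrier A \<Longrightarrow> join A x (meet A x y) = x"
    and distrib: "x \<in> carrier A \<Longrightarrow> y \<in> carrier A \<Longrightarrow> z \<in> carrier A \<Longrightarrow>
      meet A x (join A y z) = join A (meet A x y) (meet A x z)"
    and join_bot: "x \<in> carrier A \<Longrightarrow> join A x (pbot A) = x"
    and meet_top: "x \<in> carrier A \<Longrightarrow> meet A x (ptop A) = x"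
    and pseudocomplement: "x \<in> carrier A \<Longrightarrow> y \<in> carrier A \<Longrightarrow>
      meet A y (star A x) = y \<longleftrightarrow> meet A x y = pbot A"
    \<comment> \<open>the left-hand side is the lattice order \<open>y \<le> star A x\<close>\<close>

definition palg_hom :: "'a palg \<Rightarrow> 'b palg \<Rightarrow> ('a \<Rightarrow> 'b) \<Rightarrow> bool" where
  "palg_hom A B f \<longleftrightarrow>
     f ` carrier A \<subseteq> carrier B \<and>
     (\<forall>x\<in>carrier A. \<forall>y\<in>carrier A. f (meet A x y) = meet B (f x) (f y)) \<and>
     (\<forall>x\<in>carrier A. \<forall>y\<in>carrier A. f (join A x y) = join B (f x) (f y)) \<and>
     (\<forall>x\<in>carrier A. f (star A x) = star B (f x)) \<and>
     f (pbot A) = pbot B \<and> f (ptop A) = ptop B"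

definition embeds :: "'a palg \<Rightarrow> 'b palg \<Rightarrow> bool" where
  "embeds A B \<longleftrightarrow> (\<exists>f. palg_hom A B f \<and> inj_on f (carrier A))"

definition isomorphic :: "'a palg \<Rightarrow> 'b palg \<Rightarrow> bool" where
  "isomorphic A B \<longleftrightarrow> (\<exists>f. palg_hom A B f \<and> bij_betw f (carrier A) (carrier B))"


section \<open>The algebras obtained from finite Boolean lattices by adding a new top\<close>

text \<open>\<open>Some S\<close> with \<open>S \<subseteq> {..<n}\<close> are the elements of the Boolean lattice, \<open>None\<close> is the new top.\<close>

fun Bbar_meet :: "nat set option \<Rightarrow> nat set option \<Rightarrow> nat set option" where
  "Bbar_meet None b = b"
| "Bbar_meet a None = a"
| "Bbar_meet (Some S) (Some T) = Some (S \<inter> T)"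

fun Bbar_join :: "nat set option \<Rightarrow> nat set option \<Rightarrow> nat set option" where
  "Bbar_join (Some S) (Some T) = Some (S \<union> T)"
| "Bbar_join _ _ = None"

fun Bbar_star :: "nat \<Rightarrow> nat set option \<Rightarrow> nat set option" where
  "Bbar_star n None = Some {}"
| "Bbar_star n (Some S) = (if S = {} then None else Some ({..<n} - S))"

definition Bbar :: "nat \<Rightarrow> nat set option palg" where
  "Bbar n = \<lparr>carrier = insert None (Some ` Pow {..<n}), meet = Bbar_meet, join = Bbar_join,
     star = Bbar_star n, pbot = Some {}, ptop = None\<rparr>"

lemma p_algebra_Bbar: "p_algebra (Bbar n)"
  by unfold_locales (auto simp: Bbar_def inj_image_mem_iff split: if_splits)


section \<open>Terms, identities and quasi-identities\<close>

datatype (vars: 'v) trm =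
  Var 'v
| Meet "'v trm" "'v trm"
| Join "'v trm" "'v trm"
| Star "'v trm"
| Bot
| Top

primrec eval :: "'a palg \<Rightarrow> ('v \<Rightarrow> 'a) \<Rightarrow> 'v trm \<Rightarrow> 'a" where
  "eval A \<sigma> (Var v) = \<sigma> v"
| "eval A \<sigma> (Meet s t) = meet A (eval A \<sigma> s) (eval A \<sigma> t)"
| "eval A \<sigma> (Join s t) = join A (eval A \<sigma> s) (eval A \<sigma> t)"
| "eval A \<sigma> (Star t) = star A (eval A \<sigma> t)"
| "eval A \<sigma> Bot = pbot A"
| "eval A \<sigma> Top = ptop A"

type_synonym identity = "nat trm \<times> nat trm"

text \<open>A quasi-identity is a finite list of premises together with a conclusion.\<close>

type_synonym quasi_identity = "identity list \<times> identity"

definition holds_under :: "'a palg \<Rightarrow> (nat \<Rightarrow> 'a) \<Rightarrow> identity \<Rightarrow> bool" where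
  "holds_under A \<sigma> e \<longleftrightarrow> eval A \<sigma> (fst e) = eval A \<sigma> (snd e)"

definition sat_id :: "'a palg \<Rightarrow> identity \<Rightarrow> bool" where
  "sat_id A e \<longleftrightarrow> (\<forall>\<sigma>. range \<sigma> \<subseteq> carrier A \<longrightarrow> holds_under A \<sigma> e)"

definition sat_qid :: "'a palg \<Rightarrow> quasi_identity \<Rightarrow> bool" where
  "sat_qid A q \<longleftrightarrow> (\<forall>\<sigma>. range \<sigma> \<subseteq> carrier A \<longrightarrow>
     (\<forall>e\<in>set (fst q). holds_under A \<sigma> e) \<longrightarrow> holds_under A \<sigma> (snd q))"


section \<open>Varieties and quasivarieties\<close>

text \<open>
  A (quasi)variety is the class of all p-algebras satisfying some set of (quasi-)identities. A class
  of algebras appears as a set \<open>'u palg set\<close>, for each type \<open>'u\<close> of carrier elements. Since \<open>Mod_id\<close>,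
  \<open>Mod_qid\<close>, \<open>variety_of\<close> and \<open>quasivariety_of\<close> are polymorphic in the type of the resulting algebras, the axioms determine
  the class on every type, and \<open>variety_of K\<close> and \<open>quasivariety_of K\<close> need not live on the same type as \<open>K\<close>.
  Since a failing quasi-identity fails already in a finitely generated, hence countable, subalgebra,
  two quasivarieties are equal iff they contain the same algebras on one (equivalently, every)
  infinite type \<open>'u\<close>.
\<close>

definition Mod_id :: "identity set \<Rightarrow> 'u palg set" where
  "Mod_id E = {A. p_algebra A \<and> (\<forall>e\<in>E. sat_id A e)}"

definition Mod_qid :: "quasi_identity set \<Rightarrow> 'u palg set" where
  "Mod_qid \<Gamma> = {A. p_algebra A \<and> (\<forall>q\<in>\<Gamma>. sat_qid A q)}"

text \<open>The smallest variety and the smallest quasivariety containing a class \<open>K\<close> of p-algebras.\<close>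

definition variety_of :: "'k palg set \<Rightarrow> 'u palg set" where
  "variety_of K = \<Inter> {Mod_id E | E. K \<subseteq> Mod_id E}"

definition quasivariety_of :: "'k palg set \<Rightarrow> 'u palg set" where
  "quasivariety_of K = \<Inter> {Mod_qid \<Gamma> | \<Gamma>. K \<subseteq> Mod_qid \<Gamma>}"

definition Pa :: "nat \<Rightarrow> 'u palg set" where
  "Pa n = variety_of {Bbar n}"


section \<open>Free algebras\<close>

definition term_alg :: "'x set \<Rightarrow> 'x trm palg" where
  "term_alg X = \<lparr>carrier = {t. vars t \<subseteq> X}, meet = Meet, join = Join, star = Star,
     pbot = Bot, ptop = Top\<rparr>"

definition congruence :: "'a palg \<Rightarrow> ('a \<times> 'a) set \<Rightarrow> bool" where
  "congruence A \<theta> \<longleftrightarrow> equiv (carrier A) \<theta> \<and>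
     (\<forall>(x, x') \<in> \<theta>. \<forall>(y, y') \<in> \<theta>. (meet A x y, meet A x' y') \<in> \<theta>) \<and>
     (\<forall>(x, x') \<in> \<theta>. \<forall>(y, y') \<in> \<theta>. (join A x y, join A x' y') \<in> \<theta>) \<and>
     (\<forall>(x, x') \<in> \<theta>. (star A x, star A x') \<in> \<theta>)"

definition quotient_alg :: "'a palg \<Rightarrow> ('a \<times> 'a) set \<Rightarrow> 'a set palg" where
  "quotient_alg A \<theta> = \<lparr>carrier = carrier A // \<theta>,
     meet = (\<lambda>a b. \<Union>x\<in>a. \<Union>y\<in>b. \<theta> `` {meet A x y}),
     join = (\<lambda>a b. \<Union>x\<in>a. \<Union>y\<in>b. \<theta> `` {join A x y}),
     star = (\<lambda>a. \<Union>x\<in>a. \<theta> `` {star A x}),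
     pbot = \<theta> `` {pbot A}, ptop = \<theta> `` {ptop A}\<rparr>"

text \<open>
  The free algebra over \<open>X\<close> in a variety \<open>W\<close>, in its standard construction: the algebra of terms
  over \<open>X\<close> modulo the least congruence whose quotient belongs to \<open>W\<close>. The free generators are
  the classes of the \<open>Var x\<close> with \<open>x \<in> X\<close>.
\<close>

definition free_cong :: "'x trm set palg set \<Rightarrow> 'x set \<Rightarrow> ('x trm \<times> 'x trm) set" where
  "free_cong W X =
     \<Inter> {\<theta>. congruence (term_alg X) \<theta> \<and> quotient_alg (term_alg X) \<theta> \<in> W}"

definition free_alg :: "'x trm set palg set \<Rightarrow> 'x set \<Rightarrow> 'x trm set palg" where
  "free_alg W X = quotient_alg (term_alg X) (free_cong W X)"

definition free_Pa :: "nat \<Rightarrow> 'x set \<Rightarrow> 'x trm set palg" where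
  "free_Pa n X = free_alg (Pa n) X"

text \<open>
  Free p-algebras up to isomorphism. Taking the generators from the type of the elements of \<open>A\<close> is
  no restriction: in a nontrivial variety the generators are distinct elements of the free algebra,
  and in the trivial variety every free algebra is isomorphic to the one over \<open>{}\<close>.
\<close>

definition free_p_algebra :: "'a palg \<Rightarrow> bool" where
  "free_p_algebra A \<longleftrightarrow> p_algebra A \<and>
     (\<exists>(E :: identity set) (X :: 'a set). isomorphic A (free_alg (Mod_id E) X))"


section \<open>The quasi-identity excluding the algebra \<open>Bbar 3\<close>\<close>

text \<open>
  \<open>x \<squnion> y = z\<^sup>* \<and> x \<squnion> z = y\<^sup>* \<and> y \<squnion> z = x\<^sup>* \<longrightarrow> x \<squnion> y \<squnion> z = 1\<close>. Lemma \<open>sat_qb3_iff\<close> below is the property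
  that characterises \<open>qb3\<close> up to equivalence.
\<close>

definition qb3 :: quasi_identity where
  "qb3 =
     ([(Join (Var 0) (Var 1), Star (Var 2)),
       (Join (Var 0) (Var 2), Star (Var 1)),
       (Join (Var 1) (Var 2), Star (Var 0))],
      (Join (Join (Var 0) (Var 1)) (Var 2), Top))"

definition Pa3_minus :: "'u palg set" where
  "Pa3_minus = Pa 3 \<inter> Mod_qid {qb3}"

context p_algebra
begin

lemma meet_idem: "x \<in> carrier A \<Longrightarrow> meet A x x = x"
  by (metis join_absorb meet_absorb meet_closed)

lemma join_idem: "x \<in> carrier A \<Longrightarrow> join A x x = x"
  by (metis join_absorb meet_absorb join_closed)

lemma meet_bot: "x \<in> carrier A \<Longrightarrow> meet A x (pbot A) = pbot A"
  by (metis bot_closed join_bot join_comm meet_absorb meet_comm)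

lemma bot_meet: "x \<in> carrier A \<Longrightarrow> meet A (pbot A) x = pbot A"
  by (metis bot_closed meet_bot meet_comm)

lemma bot_join: "x \<in> carrier A \<Longrightarrow> join A (pbot A) x = x"
  by (metis bot_closed join_bot join_comm)

lemma top_meet: "x \<in> carrier A \<Longrightarrow> meet A (ptop A) x = x"
  by (metis top_closed meet_top meet_comm)

lemma top_join: "x \<in> carrier A \<Longrightarrow> join A (ptop A) x = ptop A"
  by (metis join_absorb meet_comm meet_top top_closed)

lemma join_top: "x \<in> carrier A \<Longrightarrow> join A x (ptop A) = ptop A"
  by (metis top_closed top_join join_comm)

lemma join_left_comm: "x \<in> carrier A \<Longrightarrow> y \<in> carrier A \<Longrightarrow> z \<in> carrier A \<Longrightarrow>
    join A x (join A y z) = join A y (join A x z)"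
  by (metis join_assoc join_comm)

lemma join_left_idem: "x \<in> carrier A \<Longrightarrow> y \<in> carrier A \<Longrightarrow> join A x (join A x y) = join A x y"
  by (metis join_assoc join_idem)

lemma distrib2: "x \<in> carrier A \<Longrightarrow> y \<in> carrier A \<Longrightarrow> z \<in> carrier A \<Longrightarrow>
    meet A (join A y z) x = join A (meet A y x) (meet A z x)"
  by (metis distrib join_closed meet_comm)

lemma meet_star: "x \<in> carrier A \<Longrightarrow> meet A x (star A x) = pbot A"
  by (metis meet_idem pseudocomplement star_closed)

lemma join_eq_bot: "x \<in> carrier A \<Longrightarrow> y \<in> carrier A \<Longrightarrow> join A x y = pbot A \<Longrightarrow> x = pbot A"
  by (metis meet_absorb meet_bot)

lemma star_unique:
  assumes "x \<in> carrier A" "s \<in> carrier A"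
    and "\<And>y. y \<in> carrier A \<Longrightarrow> meet A y s = y \<longleftrightarrow> meet A x y = pbot A"
  shows "star A x = s"
  by (metis assms meet_comm meet_idem pseudocomplement star_closed)

lemma star_bot: "star A (pbot A) = ptop A"
  by (rule star_unique) (auto simp: bot_closed top_closed meet_top bot_meet)

lemma star_top: "star A (ptop A) = pbot A"
  by (metis meet_star star_closed top_closed top_meet)

lemma star_join:
  assumes "x \<in> carrier A" "y \<in> carrier A"
  shows "star A (join A x y) = meet A (star A x) (star A y)"
proof (rule star_unique)
  fix u assume u: "u \<in> carrier A"
  have "meet A u (meet A (star A x) (star A y)) = u \<longleftrightarrow>
      meet A u (star A x) = u \<and> meet A u (star A y) = u"
    by (smt (verit) assms meet_assoc meet_closed meet_comm meet_idem star_closed u)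
  also have "\<dots> \<longleftrightarrow> meet A x u = pbot A \<and> meet A y u = pbot A"
    using assms u by (simp add: pseudocomplement)
  also have "\<dots> \<longleftrightarrow> meet A (join A x y) u = pbot A"
    using assms u by (metis distrib2 join_bot join_comm join_eq_bot meet_closed bot_closed)
  finally show "meet A u (meet A (star A x) (star A y)) = u \<longleftrightarrow> meet A (join A x y) u = pbot A" .
qed (use assms in \<open>auto intro: join_closed meet_closed star_closed\<close>)

end

lemma sat_qb3_unfold:
  "sat_qid A qb3 \<longleftrightarrow> (\<forall>x\<in>carrier A. \<forall>y\<in>carrier A. \<forall>z\<in>carrier A.
     join A x y = star A z \<longrightarrow> join A x z = star A y \<longrightarrow> join A y z = star A x \<longrightarrow>
     join A (join A x y) z = ptop A)" (is "_ \<longleftrightarrow> ?R")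
proof
  assume L: "sat_qid A qb3"
  show ?R
  proof (intro ballI impI)
    fix x y z assume xyz: "x \<in> carrier A" "y \<in> carrier A" "z \<in> carrier A"
      and eqs: "join A x y = star A z" "join A x z = star A y" "join A y z = star A x"
    let ?\<sigma> = "\<lambda>i::nat. if i = 0 then x else if i = 1 then y else z"
    have "range ?\<sigma> \<subseteq> carrier A" using xyz by auto
    with L eqs show "join A (join A x y) z = ptop A"
      unfolding sat_qid_def qb3_def holds_under_def
      by (auto dest!: spec[of _ ?\<sigma>])
  qed
next
  assume ?R then show "sat_qid A qb3"
    by (auto simp: sat_qid_def qb3_def holds_under_def image_subset_iff)
qed

lemma lt3: "{..<3} = {0, 1, 2 :: nat}"
  by auto

lemma sat_qb3_iff:
  assumes "p_algebra A"
  shows "sat_qid A qb3 \<longleftrightarrow> \<not> embeds (Bbar 3) A"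
proof -
  interpret p_algebra A by fact
  have "\<not> sat_qid A qb3" if "embeds (Bbar 3) A"
  proof
    assume sat: "sat_qid A qb3"
    from that obtain f where f: "palg_hom (Bbar 3) A f" and inj: "inj_on f (carrier (Bbar 3))"
      by (auto simp: embeds_def)
    have sub: "Some S \<in> carrier (Bbar 3)" if "S \<subseteq> {0, 1, 2}" for S
      using that unfolding lt3 by (simp add: Bbar_def lt3)
    have j: "f (Some (S \<union> T)) = join A (f (Some S)) (f (Some T))"
      if "S \<subseteq> {0, 1, 2}" "T \<subseteq> {0, 1, 2}" for S T
    proof -
      have "f (join (Bbar 3) (Some S) (Some T)) = join A (f (Some S)) (f (Some T))"
        using f sub[OF that(1)] sub[OF that(2)] unfolding palg_hom_def by blast
      then show ?thesis by (simp add: Bbar_def)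
    qed
    have s: "f (Some ({..<3} - S)) = star A (f (Some S))"
      if "S \<subseteq> {0, 1, 2}" "S \<noteq> {}" for S
    proof -
      have "f (star (Bbar 3) (Some S)) = star A (f (Some S))"
        using f sub[OF that(1)] unfolding palg_hom_def by blast
      then show ?thesis using that(2) by (simp add: Bbar_def)
    qed
    let ?x = "f (Some {0})" and ?y = "f (Some {1})" and ?z = "f (Some {2})"
    have c: "?x \<in> carrier A" "?y \<in> carrier A" "?z \<in> carrier A"
      using f sub by (auto simp: palg_hom_def)
    have d: "{..<3} - {2} = {0::nat} \<union> {1}" "{..<3} - {1} = {0::nat} \<union> {2}"
      "{..<3} - {0} = {1::nat} \<union> {2}"
      by auto
    have "join A ?x ?y = star A ?z" "join A ?x ?z = star A ?y" "join A ?y ?z = star A ?x"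
      using j[of "{0}" "{1}"] s[of "{2}"] j[of "{0}" "{2}"] s[of "{1}"] j[of "{1}" "{2}"] s[of "{0}"]
      unfolding d by simp_all
    then have "join A (join A ?x ?y) ?z = ptop A"
      using sat c unfolding sat_qb3_unfold by blast
    then have "f (Some {0, 1, 2}) = f None"
      using j[of "{0}" "{1}"] j[of "{0, 1}" "{2}"] f
      by (simp add: palg_hom_def Bbar_def insert_commute)
    then have "Some {0, 1, 2} = (None :: nat set option)"
      by (rule inj_onD[OF inj]) (auto simp: sub, simp add: Bbar_def)
    then show False by simp
  qed
  moreover have "embeds (Bbar 3) A" if nsat: "\<not> sat_qid A qb3"
  proof -
    from nsat obtain x y z where c [simp]: "x \<in> carrier A" "y \<in> carrier A" "z \<in> carrier A"
      and e: "join A x y = star A z" "join A x z = star A y" "join A y z = star A x"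
      and ntop: "join A (join A x y) z \<noteq> ptop A"
      unfolding sat_qb3_unfold by blast
    note [simp] = bot_closed top_closed meet_closed join_closed star_closed
    have orth: "meet A x y = pbot A" "meet A x z = pbot A" "meet A y z = pbot A"
      using meet_star[of x] meet_star[of y] e
      by (metis c distrib join_eq_bot join_comm meet_closed)+
    then have orth': "meet A y x = pbot A" "meet A z x = pbot A" "meet A z y = pbot A"
      using meet_comm c by metis+
    have nz: "x \<noteq> pbot A" "y \<noteq> pbot A" "z \<noteq> pbot A"
      using ntop e star_bot by (metis c join_assoc join_bot join_comm star_closed top_join join_top)+
    note rules = distrib distrib2 orth orth' meet_idem join_idem join_left_idem meet_bot bot_meet
      join_bot bot_join join_assoc join_comm join_left_comm
    have ss: "star A (join A x y) = z" "star A (join A x z) = y" "star A (join A y z) = x"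
      using e by (simp_all add: star_join flip: e) (simp_all add: rules)
    have sss: "star A (join A x (join A y z)) = pbot A"
    proof -
      have "star A (join A x (join A y z)) = meet A (join A y z) x"
        by (subst star_join) (simp_all add: ss e[symmetric])
      then show ?thesis by (simp add: rules)
    qed
    define g where "g S = join A (if 0 \<in> S then x else pbot A)
      (join A (if 1 \<in> S then y else pbot A) (if 2 \<in> S then z else pbot A))" for S :: "nat set"
    define f where "f a = (case a of None \<Rightarrow> ptop A | Some S \<Rightarrow> g S)" for a
    have gc [simp]: "g S \<in> carrier A" for S by (simp add: g_def)
    have gm: "g (S \<inter> T) = meet A (g S) (g T)" for S T
      by (simp add: g_def rules)
    have gj: "g (S \<union> T) = join A (g S) (g T)" for S T
      by (simp add: g_def rules)
    have three: "S = {} \<longleftrightarrow> 0 \<notin> S \<and> 1 \<notin> S \<and> 2 \<notin> S" if "S \<subseteq> {..<3}" for S :: "nat set"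
      using that unfolding lt3 by auto
    have gs: "(if S = {} then ptop A else g ({..<3} - S)) = star A (g S)" if "S \<subseteq> {..<3}" for S
      unfolding three[OF that]
      by (simp add: g_def join_bot bot_join star_bot ss sss e[symmetric])
    have g_inj: "S \<subseteq> T" if "g S = g T" "S \<subseteq> {..<3}" for S T
    proof -
      have "meet A x (g S) = (if 0 \<in> S then x else pbot A)"
        "meet A y (g S) = (if 1 \<in> S then y else pbot A)"
        "meet A z (g S) = (if 2 \<in> S then z else pbot A)" for S
        by (simp_all add: g_def rules)
      then have "i \<in> T" if "i \<in> S" "i \<in> {0, 1, 2}" for i
        using \<open>g S = g T\<close> nz that by (metis empty_iff insert_iff)
      then show ?thesis using that(2) unfolding lt3 by blast
    qed
    have g_eq: "S = T" if "g S = g T" "S \<subseteq> {..<3}" "T \<subseteq> {..<3}" for S T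
      using g_inj[of S T] g_inj[of T S] that by auto
    have gtop: "g S \<noteq> ptop A" for S
    proof
      assume "g S = ptop A"
      then have "g (S \<union> {0, 1, 2}) = ptop A" by (simp add: gj top_join del: Un_insert_right)
      then show False using ntop by (simp add: g_def join_assoc)
    qed
    have "palg_hom (Bbar 3) A f"
      unfolding palg_hom_def
      by (auto simp: Bbar_def f_def gm gj meet_top top_meet join_top top_join star_top gs[symmetric]
          simp flip: gs) (auto simp: g_def join_bot)
    moreover have "inj_on f (carrier (Bbar 3))"
      by (rule inj_onI) (auto simp: Bbar_def f_def gtop gtop[symmetric] dest!: g_eq)
    ultimately show ?thesis by (auto simp: embeds_def)
  qed
  ultimately show ?thesis by blast
qed

lemma Mod_qb3: "Mod_qid {qb3} = {A. p_algebra A \<and> \<not> embeds (Bbar 3) A}"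
  by (auto simp: Mod_qid_def sat_qb3_iff)

end

theory Submission
  imports Defs
begin

text \<open>
  A single quasi-identity \<open>pairs_qid\<close> separates all free algebras from \<open>Mod_qid {qb3}\<close>. It says that
  four pairwise disjoint elements whose binary joins are regular (equal to their double
  pseudocomplements) and whose total join is dense have total join 1.

  Every free algebra satisfies it. Let \<open>F\<close> be free in a variety \<open>W\<close>. If \<open>Bbar 2 \<in> W\<close>, then the join of
  two disjoint nonzero elements of \<open>F\<close> is never regular (\<open>free_alg_disjoint_join\<close>): a nonzero element
  is sent to 1 by some homomorphism into the two-element algebra, and by freeness the two
  homomorphisms obtained for the two elements can be glued to one homomorphism into \<open>Bbar 2\<close>, which
  sends them to the two atoms; but the join of the atoms is dense and different from 1. Hence at most
  one of the four elements in \<open>pairs_qid\<close> is nonzero, and the total join is one of the regular binary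
  joins. If \<open>Bbar 2 \<notin> W\<close>, then \<open>Bbar 2\<close> does not embed into \<open>F\<close>, so \<open>F\<close> is a Stone algebra
  (\<open>not_Stone_embeds_Bbar2\<close>), in which regular elements have complements; a join of two regular
  elements is then regular, and being dense it is 1.

  In p-algebras \<open>pairs_qid\<close> implies \<open>qb3\<close>: add 0 as a fourth element to the three of \<open>qb3\<close>. This gives
  the inclusion in the first part.

  The inclusion is proper, and the second part holds, because of the algebra \<open>triples\<close>. Its dual poset
  consists of four minimal points and, for each three of them, one maximal point above exactly these
  three. The four atoms refute \<open>pairs_qid\<close>. The algebra belongs to \<open>Pa 3\<close> since every maximal point
  yields a homomorphism into \<open>Bbar 3\<close>, and these homomorphisms separate the elements. It satisfies
  \<open>qb3\<close> for a combinatorial reason: a failure of \<open>qb3\<close> colours the four minimal points with three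
  colours in such a way that one of the triples sees all colours and none sees exactly two. But if a
  triple sees all colours, then the fourth point repeats the colour of one of its points, and these
  two points together with a third form a triple with exactly two colours.
\<close>

section \<open>Homomorphisms and algebras separated by homomorphisms\<close>

definition closed_alg :: "'a palg \<Rightarrow> bool" where
  "closed_alg A \<longleftrightarrow> pbot A \<in> carrier A \<and> ptop A \<in> carrier A \<and>
     (\<forall>x\<in>carrier A. star A x \<in> carrier A) \<and>
     (\<forall>x\<in>carrier A. \<forall>y\<in>carrier A. meet A x y \<in> carrier A \<and> join A x y \<in> carrier A)"

lemma closed_alg_p_algebra: "p_algebra A \<Longrightarrow> closed_alg A"
  by (auto simp: closed_alg_def p_algebra_def)

lemma palg_homD:
  assumes "palg_hom A B f"
  shows "x \<in> carrier A \<Longrightarrow> f x \<in> carrier B"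
    and "x \<in> carrier A \<Longrightarrow> y \<in> carrier A \<Longrightarrow> f (meet A x y) = meet B (f x) (f y)"
    and "x \<in> carrier A \<Longrightarrow> y \<in> carrier A \<Longrightarrow> f (join A x y) = join B (f x) (f y)"
    and "x \<in> carrier A \<Longrightarrow> f (star A x) = star B (f x)"
    and "f (pbot A) = pbot B" and "f (ptop A) = ptop B"
  using assms by (auto simp: palg_hom_def)

lemma eval_closed:
  assumes "closed_alg A" "\<And>v. v \<in> vars t \<Longrightarrow> \<sigma> v \<in> carrier A"
  shows "eval A \<sigma> t \<in> carrier A"
  using assms(2) by (induction t) (use assms(1) in \<open>auto simp: closed_alg_def\<close>)

lemma eval_hom:
  assumes "closed_alg A" "palg_hom A B f" "\<And>v. v \<in> vars t \<Longrightarrow> \<sigma> v \<in> carrier A"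
  shows "f (eval A \<sigma> t) = eval B (\<lambda>v. f (\<sigma> v)) t"
  using assms(3)
  by (induction t) (simp_all add: palg_homD[OF assms(2)] eval_closed[OF assms(1)])

lemma sat_qid_embedding:
  assumes cl: "closed_alg A" and f: "palg_hom A B f" "inj_on f (carrier A)" and B: "sat_qid B q"
  shows "sat_qid A q"
  unfolding sat_qid_def
proof (intro allI impI)
  fix \<sigma> :: "nat \<Rightarrow> 'a"
  assume \<sigma>: "range \<sigma> \<subseteq> carrier A" and prem: "\<forall>e\<in>set (fst q). holds_under A \<sigma> e"
  have transfer: "holds_under A \<sigma> e \<longleftrightarrow> holds_under B (\<lambda>v. f (\<sigma> v)) e" for e
  proof -
    have in_A: "eval A \<sigma> t \<in> carrier A" for t
      using \<sigma> by (intro eval_closed[OF cl]) auto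
    have "f (eval A \<sigma> t) = eval B (\<lambda>v. f (\<sigma> v)) t" for t
      using \<sigma> by (intro eval_hom[OF cl f(1)]) auto
    then show ?thesis
      unfolding holds_under_def by (metis in_A f(2) inj_onD)
  qed
  have "range (\<lambda>v. f (\<sigma> v)) \<subseteq> carrier B"
    using \<sigma> palg_homD(1)[OF f(1)] by auto
  then show "holds_under A \<sigma> (snd q)"
    using B prem unfolding sat_qid_def transfer by blast
qed

text \<open>
  An algebra separated by homomorphisms into members of a variety is a subdirect product of them.
  The pseudocomplement law is an equivalence and not an identity, but both of its sides are
  equations, so it can still be checked under each of the separating homomorphisms.
\<close>

lemma Mod_id_if_separated:
  fixes A :: "'a palg" and E :: "identity set"
  assumes cl: "closed_alg A"
    and sep: "\<And>x y. x \<in> carrier A \<Longrightarrow> y \<in> carrier A \<Longrightarrow> x \<noteq> y \<Longrightarrow>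
      \<exists>B\<in>(Mod_id E :: 'b palg set). \<exists>h. palg_hom A B h \<and> h x \<noteq> h y"
  shows "A \<in> Mod_id E"
proof -
  have eqI: "x = y" if "x \<in> carrier A" "y \<in> carrier A"
      "\<And>(B :: 'b palg) h. B \<in> Mod_id E \<Longrightarrow> palg_hom A B h \<Longrightarrow> h x = h y" for x y
    using sep that by blast
  have MD: "p_algebra B" if "B \<in> Mod_id E" for B :: "'b palg"
    using that by (simp add: Mod_id_def)
  note [simp] = cl[unfolded closed_alg_def, THEN conjunct1]
    cl[unfolded closed_alg_def, THEN conjunct2, THEN conjunct1]
    cl[unfolded closed_alg_def, THEN conjunct2, THEN conjunct2, THEN conjunct1, rule_format]
    cl[unfolded closed_alg_def, THEN conjunct2, THEN conjunct2, THEN conjunct2, rule_format,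
      THEN conjunct1]
    cl[unfolded closed_alg_def, THEN conjunct2, THEN conjunct2, THEN conjunct2, rule_format,
      THEN conjunct2]
  have "p_algebra A"
  proof
    fix x y z assume "x \<in> carrier A" "y \<in> carrier A" "z \<in> carrier A"
    then show "meet A (meet A x y) z = meet A x (meet A y z)"
      "join A (join A x y) z = join A x (join A y z)"
      "meet A x (join A y z) = join A (meet A x y) (meet A x z)"
      by (rule_tac eqI, simp, simp, simp add: palg_homD p_algebra.meet_assoc[OF MD]
          p_algebra.join_assoc[OF MD] p_algebra.distrib[OF MD])+
  next
    fix x y assume xy: "x \<in> carrier A" "y \<in> carrier A"
    then show "meet A x y = meet A y x" "join A x y = join A y x"
      "meet A x (join A x y) = x" "join A x (meet A x y) = x"
      by (rule_tac eqI, simp, simp, simp add: palg_homD p_algebra.meet_comm[OF MD]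
          p_algebra.join_comm[OF MD] p_algebra.meet_absorb[OF MD] p_algebra.join_absorb[OF MD])+
    show "meet A y (star A x) = y \<longleftrightarrow> meet A x y = pbot A"
    proof
      assume e: "meet A y (star A x) = y"
      show "meet A x y = pbot A"
      proof (rule eqI)
        fix B :: "'b palg" and h assume Bh: "B \<in> Mod_id E" "palg_hom A B h"
        have "meet B (h y) (star B (h x)) = h y"
          using arg_cong[OF e, of h] xy by (simp add: palg_homD[OF Bh(2)])
        then show "h (meet A x y) = h (pbot A)"
          using xy p_algebra.pseudocomplement[OF MD[OF Bh(1)]] by (simp add: palg_homD[OF Bh(2)])
      qed (use xy in simp_all)
    next
      assume e: "meet A x y = pbot A"
      show "meet A y (star A x) = y"
      proof (rule eqI)
        fix B :: "'b palg" and h assume Bh: "B \<in> Mod_id E" "palg_hom A B h"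
        have "meet B (h x) (h y) = pbot B"
          using arg_cong[OF e, of h] xy by (simp add: palg_homD[OF Bh(2)])
        then show "h (meet A y (star A x)) = h y"
          using xy p_algebra.pseudocomplement[OF MD[OF Bh(1)]] by (simp add: palg_homD[OF Bh(2)])
      qed (use xy in simp_all)
    qed
  next
    fix x assume "x \<in> carrier A"
    then show "join A x (pbot A) = x" "meet A x (ptop A) = x"
      by (rule_tac eqI, simp, simp, simp add: palg_homD p_algebra.join_bot[OF MD]
          p_algebra.meet_top[OF MD])+
  qed auto
  moreover have "sat_id A e" if e: "e \<in> E" for e
    unfolding sat_id_def holds_under_def
  proof (intro allI impI)
    fix \<sigma> :: "nat \<Rightarrow> 'a" assume "range \<sigma> \<subseteq> carrier A"
    then have \<sigma>: "\<sigma> v \<in> carrier A" for v by auto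
    show "eval A \<sigma> (fst e) = eval A \<sigma> (snd e)"
    proof (rule eqI)
      fix B :: "'b palg" and h assume Bh: "B \<in> Mod_id E" "palg_hom A B h"
      have "range (\<lambda>v. h (\<sigma> v)) \<subseteq> carrier B"
        using \<sigma> palg_homD(1)[OF Bh(2)] by auto
      then show "h (eval A \<sigma> (fst e)) = h (eval A \<sigma> (snd e))"
        using Bh(1) e \<sigma> by (simp add: eval_hom[OF cl Bh(2)] Mod_id_def sat_id_def holds_under_def)
    qed (auto intro: eval_closed[OF cl] \<sigma>)
  qed
  ultimately show ?thesis by (simp add: Mod_id_def)
qed

lemma Mod_id_embedding:
  assumes "closed_alg A" "palg_hom A B f" "inj_on f (carrier A)" "B \<in> Mod_id E"
  shows "A \<in> Mod_id E"
  using assms by (intro Mod_id_if_separated) (auto dest: inj_onD)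

text \<open>Quasivarieties are compared on an infinite type, so a finite witness has to be moved there.\<close>

lemma finite_alg_copy:
  fixes A :: "'a palg"
  assumes cl: "closed_alg A" and fin: "finite (carrier A)"
  obtains B :: "('u :: infinite) palg" and f g
  where "closed_alg B" "palg_hom A B f" "inj_on f (carrier A)"
    "palg_hom B A g" "inj_on g (carrier B)"
proof -
  obtain C :: "'u set" where "finite C" "card C = card (carrier A)"
    using infinite_arbitrarily_large[OF infinite_UNIV] by blast
  then obtain f where f: "bij_betw f (carrier A) C"
    using finite_same_card_bij[OF fin] by metis
  define g where "g = inv_into (carrier A) f"
  define B where "B = \<lparr>carrier = C, meet = (\<lambda>x y. f (meet A (g x) (g y))),
    join = (\<lambda>x y. f (join A (g x) (g y))), star = (\<lambda>x. f (star A (g x))),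
    pbot = f (pbot A), ptop = f (ptop A)\<rparr>"
  have fC: "f x \<in> C" and gf: "g (f x) = x" if "x \<in> carrier A" for x
    using f that by (auto simp: bij_betw_def g_def)
  have gA: "g y \<in> carrier A" if "y \<in> C" for y
    using f that by (auto simp: bij_betw_def g_def inv_into_into)
  have g_inj: "inj_on g C"
    using f by (auto simp: bij_betw_def g_def inj_on_inv_into)
  show ?thesis
  proof
    show "closed_alg B" "palg_hom A B f" "palg_hom B A g"
      using cl by (auto simp: closed_alg_def palg_hom_def B_def fC gf gA)
    show "inj_on f (carrier A)" "inj_on g (carrier B)"
      using f g_inj by (simp_all add: bij_betw_def B_def)
  qed
qed

section \<open>Free algebras\<close>

lemma congruenceD:
  assumes "congruence A \<theta>"
  shows "equiv (carrier A) \<theta>"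
    and "(x, x') \<in> \<theta> \<Longrightarrow> (y, y') \<in> \<theta> \<Longrightarrow> (meet A x y, meet A x' y') \<in> \<theta>"
    and "(x, x') \<in> \<theta> \<Longrightarrow> (y, y') \<in> \<theta> \<Longrightarrow> (join A x y, join A x' y') \<in> \<theta>"
    and "(x, x') \<in> \<theta> \<Longrightarrow> (star A x, star A x') \<in> \<theta>"
  using assms unfolding congruence_def by blast+

lemma class_ops:
  assumes \<theta>: "congruence A \<theta>"
  shows "x \<in> carrier A \<Longrightarrow> y \<in> carrier A \<Longrightarrow>
      meet (quotient_alg A \<theta>) (\<theta> `` {x}) (\<theta> `` {y}) = \<theta> `` {meet A x y}"
    and "x \<in> carrier A \<Longrightarrow> y \<in> carrier A \<Longrightarrow>
      join (quotient_alg A \<theta>) (\<theta> `` {x}) (\<theta> `` {y}) = \<theta> `` {join A x y}"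
    and "x \<in> carrier A \<Longrightarrow> star (quotient_alg A \<theta>) (\<theta> `` {x}) = \<theta> `` {star A x}"
proof -
  note eq = congruenceD(1)[OF \<theta>]
  have ne: "x \<in> \<theta> `` {x}" if "x \<in> carrier A" for x
    using eq that by (rule equiv_class_self)
  have collect2: "(\<Union>x'\<in>\<theta> `` {x}. \<Union>y'\<in>\<theta> `` {y}. \<theta> `` {f x' y'}) = \<theta> `` {f x y}"
    if "x \<in> carrier A" "y \<in> carrier A"
      "\<And>x' y'. (x, x') \<in> \<theta> \<Longrightarrow> (y, y') \<in> \<theta> \<Longrightarrow> (f x y, f x' y') \<in> \<theta>" for f x y
  proof -
    have "\<theta> `` {f x' y'} = \<theta> `` {f x y}" if "x' \<in> \<theta> `` {x}" "y' \<in> \<theta> `` {y}" for x' y'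
      using equiv_class_eq[OF eq] \<open>\<And>x' y'. _ \<Longrightarrow> _ \<Longrightarrow> (f x y, f x' y') \<in> \<theta>\<close> that by blast
    then show ?thesis using ne[OF that(1)] ne[OF that(2)] by blast
  qed
  show "meet (quotient_alg A \<theta>) (\<theta> `` {x}) (\<theta> `` {y}) = \<theta> `` {meet A x y}"
    if "x \<in> carrier A" "y \<in> carrier A"
    using collect2[OF that, where f = "meet A"] congruenceD(2)[OF \<theta>] by (simp add: quotient_alg_def)
  show "join (quotient_alg A \<theta>) (\<theta> `` {x}) (\<theta> `` {y}) = \<theta> `` {join A x y}"
    if "x \<in> carrier A" "y \<in> carrier A"
    using collect2[OF that, where f = "join A"] congruenceD(3)[OF \<theta>] by (simp add: quotient_alg_def)
  show "star (quotient_alg A \<theta>) (\<theta> `` {x}) = \<theta> `` {star A x}" if x: "x \<in> carrier A"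
  proof -
    have "\<theta> `` {star A x'} = \<theta> `` {star A x}" if "x' \<in> \<theta> `` {x}" for x'
      using equiv_class_eq[OF eq] congruenceD(4)[OF \<theta>] that by blast
    then have "(\<Union>x'\<in>\<theta> `` {x}. \<theta> `` {star A x'}) = \<theta> `` {star A x}" using ne[OF x] by blast
    then show ?thesis by (simp add: quotient_alg_def)
  qed
qed

lemma quotient_alg_simps:
  "carrier (quotient_alg A \<theta>) = (\<lambda>x. \<theta> `` {x}) ` carrier A"
  "pbot (quotient_alg A \<theta>) = \<theta> `` {pbot A}" "ptop (quotient_alg A \<theta>) = \<theta> `` {ptop A}"
  by (auto simp: quotient_alg_def quotient_def)

lemma closed_quotient:
  assumes "closed_alg A" "congruence A \<theta>"
  shows "closed_alg (quotient_alg A \<theta>)"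
  using assms(1) unfolding closed_alg_def
  by (simp add: class_ops[OF assms(2)] quotient_alg_simps del: Image_singleton_iff)

lemma palg_hom_class:
  assumes "congruence A \<theta>"
  shows "palg_hom A (quotient_alg A \<theta>) (\<lambda>x. \<theta> `` {x})"
  unfolding palg_hom_def by (simp add: class_ops[OF assms] quotient_alg_simps)

lemma quotient_factor:
  assumes cl: "closed_alg A" and \<theta>: "congruence A \<theta>" and f: "palg_hom A B f"
    and ker: "\<And>x y. (x, y) \<in> \<theta> \<Longrightarrow> f x = f y"
  obtains h where "palg_hom (quotient_alg A \<theta>) B h"
    "\<And>x. x \<in> carrier A \<Longrightarrow> h (\<theta> `` {x}) = f x"
proof
  let ?h = "\<lambda>C. the_elem (f ` C)"
  show h: "?h (\<theta> `` {x}) = f x" if "x \<in> carrier A" for x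
  proof -
    have "x \<in> \<theta> `` {x}"
      using congruenceD(1)[OF \<theta>] that by (rule equiv_class_self)
    moreover have "f y = f x" if "y \<in> \<theta> `` {x}" for y
      using ker[of x y] that by (simp only: Image_singleton_iff)
    ultimately have "f ` (\<theta> `` {x}) = {f x}" by blast
    then show ?thesis by simp
  qed
  show "palg_hom (quotient_alg A \<theta>) B ?h"
    using cl unfolding palg_hom_def closed_alg_def quotient_alg_simps
    by (simp add: class_ops[OF \<theta>] h palg_homD[OF f] image_subset_iff)
qed

lemma closed_term_alg: "closed_alg (term_alg X)"
  by (auto simp: closed_alg_def term_alg_def)

lemma palg_hom_eval:
  assumes "closed_alg B" "\<sigma> ` X \<subseteq> carrier B"
  shows "palg_hom (term_alg X) B (eval B \<sigma>)"
  using assms by (auto simp: palg_hom_def term_alg_def intro!: eval_closed)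

lemma congruence_kernel:
  assumes "closed_alg A" "palg_hom A B f"
  shows "congruence A {(x, y). x \<in> carrier A \<and> y \<in> carrier A \<and> f x = f y}"
  using assms(1) unfolding congruence_def closed_alg_def
  by (auto simp: palg_homD[OF assms(2)] equiv_def refl_on_def sym_def trans_def)

text \<open>
  The freeness of the free algebra: the kernel of an assignment into \<open>B \<in> Mod_id E\<close> is one of the
  congruences that \<open>free_cong\<close> intersects, because the quotient by it embeds into \<open>B\<close>.
\<close>

lemma free_cong_le_kernel:
  assumes B: "B \<in> Mod_id E" and \<sigma>: "\<sigma> ` X \<subseteq> carrier B"
    and st: "(s, t) \<in> free_cong (Mod_id E) X"
  shows "eval B \<sigma> s = eval B \<sigma> t"
proof -
  let ?T = "term_alg X"
  define \<theta> where "\<theta> = {(s, t). s \<in> carrier ?T \<and> t \<in> carrier ?T \<and> eval B \<sigma> s = eval B \<sigma> t}"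
  have "closed_alg B" using B by (simp add: Mod_id_def closed_alg_p_algebra)
  then have ev: "palg_hom ?T B (eval B \<sigma>)" using \<sigma> by (rule palg_hom_eval)
  have \<theta>: "congruence ?T \<theta>"
    unfolding \<theta>_def by (rule congruence_kernel[OF closed_term_alg ev])
  obtain h where h: "palg_hom (quotient_alg ?T \<theta>) B h"
    "\<And>s. s \<in> carrier ?T \<Longrightarrow> h (\<theta> `` {s}) = eval B \<sigma> s"
    by (rule quotient_factor[OF closed_term_alg \<theta> ev]) (auto simp: \<theta>_def)
  have "inj_on h (carrier (quotient_alg ?T \<theta>))"
  proof (rule inj_onI)
    fix C D assume "C \<in> carrier (quotient_alg ?T \<theta>)" "D \<in> carrier (quotient_alg ?T \<theta>)" "h C = h D"
    moreover from this obtain c d where "c \<in> carrier ?T" "C = \<theta> `` {c}" "d \<in> carrier ?T" "D = \<theta> `` {d}"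
      by (auto simp: quotient_alg_def quotient_def)
    ultimately show "C = D" using h(2) by (auto simp: \<theta>_def)
  qed
  then have "quotient_alg ?T \<theta> \<in> Mod_id E"
    using Mod_id_embedding[OF closed_quotient[OF closed_term_alg \<theta>] h(1)] B by blast
  then have "(s, t) \<in> \<theta>" using st \<theta> by (auto simp: free_cong_def)
  then show ?thesis by (simp add: \<theta>_def)
qed

text \<open>
  Without a member of the family, \<open>free_cong\<close> would be the intersection of the empty family. The
  trivial algebra belongs to every variety.
\<close>

lemma free_cong_family_nonempty:
  "\<exists>\<theta>. congruence (term_alg X) \<theta> \<and> quotient_alg (term_alg X) \<theta> \<in> Mod_id E"
proof -
  let ?T = "term_alg X"
  let ?\<theta> = "carrier ?T \<times> carrier ?T"
  have \<theta>: "congruence ?T ?\<theta>"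
    by (auto simp: congruence_def equiv_def refl_on_def sym_def trans_def term_alg_def)
  have "quotient_alg ?T ?\<theta> \<in> Mod_id E"
  proof (rule Mod_id_if_separated[where ?'b = unit])
    fix C D assume "C \<in> carrier (quotient_alg ?T ?\<theta>)" "D \<in> carrier (quotient_alg ?T ?\<theta>)" "C \<noteq> D"
    then show "\<exists>B\<in>Mod_id E. \<exists>h :: _ \<Rightarrow> unit. palg_hom (quotient_alg ?T ?\<theta>) B h \<and> h C \<noteq> h D"
      by (auto simp: quotient_alg_def quotient_def)
  qed (rule closed_quotient[OF closed_term_alg \<theta>])
  with \<theta> show ?thesis by blast
qed

lemma congruence_free_cong: "congruence (term_alg X) (free_cong (Mod_id E) X)"
proof -
  let ?T = "term_alg X"
  define Fam where "Fam = {\<theta>. congruence ?T \<theta> \<and> quotient_alg ?T \<theta> \<in> Mod_id E}"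
  have ne: "Fam \<noteq> {}" using free_cong_family_nonempty by (auto simp: Fam_def)
  have c: "congruence ?T \<theta>" if "\<theta> \<in> Fam" for \<theta> using that by (simp add: Fam_def)
  have eq: "equiv (carrier ?T) \<theta>" if "\<theta> \<in> Fam" for \<theta>
    using c[OF that] by (simp add: congruence_def)
  have "equiv (carrier ?T) (\<Inter>Fam)"
  proof (rule equivI)
    show "\<Inter>Fam \<subseteq> carrier ?T \<times> carrier ?T"
      using ne eq by (fastforce simp: equiv_def)
    show "refl_on (carrier ?T) (\<Inter>Fam)" 
      using eq by (auto simp: equiv_def refl_on_def)
    show "sym (\<Inter>Fam)"
      using eq unfolding equiv_def sym_def by blast
    show "trans (\<Inter>Fam)"
      using eq unfolding equiv_def trans_def by blast
  qed
  moreover have "(meet ?T x y, meet ?T x' y') \<in> \<Inter>Fam" "(join ?T x y, join ?T x' y') \<in> \<Inter>Fam"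
    if "(x, x') \<in> \<Inter>Fam" "(y, y') \<in> \<Inter>Fam" for x x' y y'
    using that by (auto intro: congruenceD(2,3)[OF c])
  moreover have "(star ?T x, star ?T x') \<in> \<Inter>Fam" if "(x, x') \<in> \<Inter>Fam" for x x'
    using that by (auto intro: congruenceD(4)[OF c])
  ultimately have "congruence ?T (\<Inter>Fam)"
    unfolding congruence_def by blast
  then show ?thesis by (simp add: free_cong_def Fam_def)
qed

text \<open>
  The free algebra is a subdirect product of the quotients whose congruences are intersected in
  \<open>free_cong\<close>.
\<close>

lemma free_alg_in_variety:
  fixes X :: "'x set"
  shows "free_alg (Mod_id E) X \<in> Mod_id E"
  unfolding free_alg_def
proof (rule Mod_id_if_separated[where ?'b = "'x trm set"])
  let ?T = "term_alg X" and ?\<theta> = "free_cong (Mod_id E) X"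
  note \<theta> = congruence_free_cong[of X E]
  show "closed_alg (quotient_alg ?T ?\<theta>)" by (rule closed_quotient[OF closed_term_alg \<theta>])
  fix C D assume "C \<in> carrier (quotient_alg ?T ?\<theta>)" "D \<in> carrier (quotient_alg ?T ?\<theta>)" and ne: "C \<noteq> D"
  then obtain c d where cd: "c \<in> carrier ?T" "C = ?\<theta> `` {c}" "d \<in> carrier ?T" "D = ?\<theta> `` {d}"
    by (auto simp: quotient_alg_def quotient_def)
  have "equiv (carrier ?T) ?\<theta>" using \<theta> by (simp add: congruence_def)
  then have "(c, d) \<notin> ?\<theta>" using ne cd by (metis equiv_class_eq)
  then obtain \<eta> where \<eta>: "congruence ?T \<eta>" "quotient_alg ?T \<eta> \<in> Mod_id E" "(c, d) \<notin> \<eta>"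
    by (auto simp: free_cong_def)
  have eq: "equiv (carrier ?T) \<eta>" using \<eta>(1) by (simp add: congruence_def)
  have "?\<theta> \<subseteq> \<eta>" using \<eta> by (auto simp: free_cong_def)
  then have ker: "\<eta> `` {x} = \<eta> `` {y}" if "(x, y) \<in> ?\<theta>" for x y
    using that by (intro equiv_class_eq[OF eq]) auto
  obtain h where h: "palg_hom (quotient_alg ?T ?\<theta>) (quotient_alg ?T \<eta>) h"
    "\<And>x. x \<in> carrier ?T \<Longrightarrow> h (?\<theta> `` {x}) = \<eta> `` {x}"
    using quotient_factor[OF closed_term_alg \<theta> palg_hom_class[OF \<eta>(1)] ker] by blast
  have "h C \<noteq> h D"
    using \<eta>(3) eq cd h(2) by (simp add: eq_equiv_class_iff)
  then show "\<exists>B\<in>Mod_id E. \<exists>h :: _ \<Rightarrow> 'x trm set. palg_hom (quotient_alg ?T ?\<theta>) B h \<and> h C \<noteq> h D"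
    using \<eta>(2) h(1) by blast
qed

section \<open>Disjoint elements of free algebras\<close>

definition two :: "bool palg" where
  "two = \<lparr>carrier = UNIV, meet = (\<and>), join = (\<or>), star = Not, pbot = False, ptop = True\<rparr>"

context p_algebra
begin

text \<open>
  An element \<open>m\<close> that lies below or is disjoint from each variable behaves like a point: relative to
  \<open>m\<close>, every term takes its two-valued truth value.
\<close>

lemma below_literals_decides:
  assumes m: "m \<in> carrier A" and \<sigma>: "\<And>x. x \<in> vars t \<Longrightarrow> \<sigma> x \<in> carrier A"
    and lit: "\<And>x. x \<in> vars t \<Longrightarrow> meet A m (\<sigma> x) = (if v x then m else pbot A)"
  shows "meet A m (eval A \<sigma> t) = (if eval two v t then m else pbot A)"
  using \<sigma> lit
proof (induction t)
  case (Meet s t)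
  then have c: "eval A \<sigma> s \<in> carrier A" "eval A \<sigma> t \<in> carrier A"
    by (auto intro!: eval_closed closed_alg_p_algebra p_algebra_axioms)
  have "meet A m (meet A (eval A \<sigma> s) (eval A \<sigma> t)) = meet A (meet A m (eval A \<sigma> s)) (eval A \<sigma> t)"
    using m c by (simp add: meet_assoc)
  then show ?case using Meet c by (simp add: two_def bot_meet)
next
  case (Join s t)
  then have c: "eval A \<sigma> s \<in> carrier A" "eval A \<sigma> t \<in> carrier A"
    by (auto intro!: eval_closed closed_alg_p_algebra p_algebra_axioms)
  then show ?case using Join m by (simp add: two_def distrib join_idem join_bot bot_join bot_closed)
next
  case (Star t)
  then have c: "eval A \<sigma> t \<in> carrier A"
    by (auto intro!: eval_closed closed_alg_p_algebra p_algebra_axioms)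
  show ?case
  proof (cases "eval two v t")
    case True
    then have "meet A m (eval A \<sigma> t) = m" using Star by simp
    then have "meet A m (star A (eval A \<sigma> t)) = meet A m (meet A (eval A \<sigma> t) (star A (eval A \<sigma> t)))"
      using m c by (metis meet_assoc star_closed)
    then show ?thesis using True m c by (simp add: two_def meet_star meet_bot)
  next
    case False
    then have "meet A (eval A \<sigma> t) m = pbot A" using Star m c by (simp add: meet_comm)
    then show ?thesis using False m c pseudocomplement[of "eval A \<sigma> t" m] by (simp add: two_def)
  qed
qed (use m in \<open>auto simp: two_def meet_bot meet_top\<close>)

text \<open>
  Such an \<open>m\<close> can be found below any nonzero element, by meeting it successively with those variables
  that keep it nonzero. This replaces the prime filter theorem for terms, which involve only
  finitely many variables.
\<close>

lemma nonzero_decided: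
  assumes "finite V" "a \<in> carrier A" "a \<noteq> pbot A" "\<And>x. x \<in> V \<Longrightarrow> \<sigma> x \<in> carrier A"
  shows "\<exists>v m. m \<in> carrier A \<and> m \<noteq> pbot A \<and> meet A m a = m \<and>
    (\<forall>x\<in>V. meet A m (\<sigma> x) = (if v x then m else pbot A))"
  using assms(1,4)
proof (induction V)
  case empty
  then show ?case using assms meet_idem by blast
next
  case (insert y V)
  then obtain v m where m: "m \<in> carrier A" "m \<noteq> pbot A" "meet A m a = m"
    and dec: "\<And>x. x \<in> V \<Longrightarrow> meet A m (\<sigma> x) = (if v x then m else pbot A)"
    by auto
  have y: "\<sigma> y \<in> carrier A" and V: "\<And>x. x \<in> V \<Longrightarrow> \<sigma> x \<in> carrier A" using insert by auto
  show ?case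
  proof (cases "meet A m (\<sigma> y) = pbot A")
    case True
    then have "\<forall>x\<in>insert y V. meet A m (\<sigma> x) = (if (v(y := False)) x then m else pbot A)"
      using dec insert.hyps by auto
    then show ?thesis using m by blast
  next
    case False
    let ?n = "meet A m (\<sigma> y)"
    have swap: "meet A ?n c = meet A (meet A m c) (\<sigma> y)" if "c \<in> carrier A" for c
      using m(1) y that by (metis meet_assoc meet_comm)
    have "meet A ?n a = ?n" using swap[OF assms(2)] m by simp
    moreover have "meet A ?n (\<sigma> y) = ?n" using m(1) y by (simp add: meet_assoc meet_idem)
    moreover have "meet A ?n (\<sigma> x) = (if v x then ?n else pbot A)" if "x \<in> V" for x
      using swap[OF V[OF that]] dec[OF that] y by (simp add: bot_meet)
    ultimately have "\<forall>x\<in>insert y V. meet A ?n (\<sigma> x) = (if (v(y := True)) x then ?n else pbot A)"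
      "meet A ?n a = ?n"
      by auto
    then show ?thesis using False m(1) y meet_closed by blast
  qed
qed

lemma nonzero_term_two_valuation:
  assumes \<sigma>: "\<And>x. x \<in> vars t \<Longrightarrow> \<sigma> x \<in> carrier A" and nz: "eval A \<sigma> t \<noteq> pbot A"
  shows "\<exists>v. eval two v t"
proof -
  have c: "eval A \<sigma> t \<in> carrier A"
    using \<sigma> by (auto intro!: eval_closed closed_alg_p_algebra p_algebra_axioms)
  have "finite (vars t)" by (induction t) auto
  from nonzero_decided[where \<sigma> = \<sigma>, OF this c nz \<sigma>]
  obtain v m where m: "m \<in> carrier A" "m \<noteq> pbot A" "meet A m (eval A \<sigma> t) = m"
    and dec: "\<And>x. x \<in> vars t \<Longrightarrow> meet A m (\<sigma> x) = (if v x then m else pbot A)"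
    by blast
  have "eval two v t"
    using below_literals_decides[where \<sigma> = \<sigma> and v = v, OF m(1) \<sigma> dec] m by (auto split: if_splits)
  then show ?thesis by blast
qed

end

text \<open>Membership in the prime filter of all elements above the \<open>i\<close>-th atom.\<close>

definition above_atom :: "nat \<Rightarrow> nat set option \<Rightarrow> bool" where
  "above_atom i a = (case a of None \<Rightarrow> True | Some S \<Rightarrow> i \<in> S)"

lemma palg_hom_above_atom: "i < n \<Longrightarrow> palg_hom (Bbar n) two (above_atom i)"
  by (auto simp: palg_hom_def Bbar_def two_def above_atom_def)

text \<open>
  Homomorphisms \<open>v\<close>, \<open>w\<close> into the two-element algebra with \<open>v x = 1\<close> and \<open>w y = 1\<close> combine, on the free
  generators, to a homomorphism into \<open>Bbar 2\<close> whose composites with the two projections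
  \<open>above_atom 0\<close> and \<open>above_atom 1\<close> are \<open>v\<close> and \<open>w\<close>. Disjoint \<open>x\<close> and \<open>y\<close> are thus sent below the new
  top, to elements whose join is the dense element below the top.
\<close>

lemma free_alg_disjoint_join:
  assumes B2: "Bbar 2 \<in> Mod_id E"
    and xy: "x \<in> carrier (free_alg (Mod_id E) X)" "y \<in> carrier (free_alg (Mod_id E) X)"
  defines "F \<equiv> free_alg (Mod_id E) X"
  assumes disj: "meet F x y = pbot F" and reg: "star F (star F (join F x y)) = join F x y"
  shows "x = pbot F \<or> y = pbot F"
proof (rule ccontr)
  assume nz: "\<not> (x = pbot F \<or> y = pbot F)"
  let ?T = "term_alg X" and ?\<theta> = "free_cong (Mod_id E) X"
  note \<theta> = congruence_free_cong[of X E]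
  have F: "F = quotient_alg ?T ?\<theta>" by (simp add: F_def free_alg_def)
  interpret p_algebra F
    using free_alg_in_variety[of E X] by (simp add: F_def Mod_id_def)
  note cls = palg_hom_class[OF \<theta>, folded F]
  obtain s t where st: "s \<in> carrier ?T" "x = ?\<theta> `` {s}" "t \<in> carrier ?T" "y = ?\<theta> `` {t}"
    using xy by (auto simp: free_alg_def quotient_alg_def quotient_def)
  have gen: "?\<theta> `` {Var i} \<in> carrier F" if "i \<in> X" for i
    using that palg_homD(1)[OF cls] by (simp add: term_alg_def)
  have eval_gen: "?\<theta> `` {r} = eval F (\<lambda>i. ?\<theta> `` {Var i}) r" if "r \<in> carrier ?T" for r
  proof -
    have "eval ?T Var r = r" by (induction r) (simp_all add: term_alg_def)
    then show ?thesis
      using eval_hom[OF closed_term_alg cls, where t = r and \<sigma> = Var] that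
      by (auto simp: term_alg_def)
  qed
  have two: "\<exists>v. eval two v r" if "r \<in> carrier ?T" "?\<theta> `` {r} \<noteq> pbot F" for r
  proof (rule nonzero_term_two_valuation)
    show "eval F (\<lambda>i. ?\<theta> `` {Var i}) r \<noteq> pbot F" using that(2) unfolding eval_gen[OF that(1)] .
    show "?\<theta> `` {Var i} \<in> carrier F" if "i \<in> vars r" for i
      using gen that \<open>r \<in> carrier ?T\<close> by (auto simp: term_alg_def)
  qed
  have "?\<theta> `` {s} \<noteq> pbot F" "?\<theta> `` {t} \<noteq> pbot F" using nz st(2,4) by simp_all
  then obtain v w where v: "eval two v s" and w: "eval two w t"
    using two[OF st(1)] two[OF st(3)] by blast
  \<comment> \<open>The glued valuation sends every generator into the Boolean part, never to the new top.\<close>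
  define \<rho> where "\<rho> i = Some ({k. k = (0::nat) \<and> v i} \<union> {k. k = 1 \<and> w i})" for i
  have \<rho>: "\<rho> i \<in> carrier (Bbar 2)" for i
    unfolding \<rho>_def Bbar_def palg.simps by (intro insertI2 imageI PowI) auto
  have B2cl: "closed_alg (Bbar 2)" by (rule closed_alg_p_algebra[OF p_algebra_Bbar])
  have mem: "above_atom 0 (eval (Bbar 2) \<rho> r) = eval two v r"
    "above_atom 1 (eval (Bbar 2) \<rho> r) = eval two w r" for r
    by (simp_all add: eval_hom[OF B2cl palg_hom_above_atom] \<rho>) 
      (simp_all add: \<rho>_def above_atom_def)
  have sound: "eval (Bbar 2) \<rho> p = eval (Bbar 2) \<rho> q"
    if "p \<in> carrier ?T" "q \<in> carrier ?T" "?\<theta> `` {p} = ?\<theta> `` {q}" for p q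
  proof -
    have "(p, q) \<in> ?\<theta>"
      using eq_equiv_class_iff[OF congruenceD(1)[OF \<theta>] that(1,2)] that(3) by (rule iffD1)
    then show ?thesis using \<rho> by (intro free_cong_le_kernel[OF B2]) auto
  qed
  have terms: "Meet s t \<in> carrier ?T" "Bot \<in> carrier ?T" "Join s t \<in> carrier ?T"
    "Star (Star (Join s t)) \<in> carrier ?T"
    using st by (auto simp: term_alg_def)
  have "?\<theta> `` {Meet s t} = ?\<theta> `` {Bot}"
    using disj st palg_homD(2,5)[OF cls] by (simp add: term_alg_def)
  then have e1: "Bbar_meet (eval (Bbar 2) \<rho> s) (eval (Bbar 2) \<rho> t) = Some {}"
    using sound[OF terms(1,2)] by (simp add: Bbar_def)
  have "?\<theta> `` {Star (Star (Join s t))} = ?\<theta> `` {Join s t}"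
    using reg st palg_homD(3,4)[OF cls] by (simp add: term_alg_def)
  then have e2: "Bbar_star 2 (Bbar_star 2 (Bbar_join (eval (Bbar 2) \<rho> s) (eval (Bbar 2) \<rho> t)))
      = Bbar_join (eval (Bbar 2) \<rho> s) (eval (Bbar 2) \<rho> t)"
    using sound[OF terms(4,3)] by (simp add: Bbar_def)
  have "eval (Bbar 2) \<rho> s \<in> carrier (Bbar 2)" "eval (Bbar 2) \<rho> t \<in> carrier (Bbar 2)"
    using \<rho> by (auto intro: eval_closed[OF B2cl])
  moreover have "above_atom 0 (eval (Bbar 2) \<rho> s)" "above_atom 1 (eval (Bbar 2) \<rho> t)"
    using v w mem by simp_all
  ultimately obtain S S' where S: "eval (Bbar 2) \<rho> s = Some S" "eval (Bbar 2) \<rho> t = Some S'"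
    "0 \<in> S" "1 \<in> S'" "S \<subseteq> {..<2}" "S' \<subseteq> {..<2}"
    using e1 by (auto simp: Bbar_def above_atom_def)
  then have "S \<union> S' = {..<2}"
    by (auto simp: less_2_cases_iff)
  then show False
    using e2 S(1-4) by (auto split: if_splits)
qed

section \<open>A quasi-identity of free algebras\<close>

definition index_pairs :: "(nat \<times> nat) list" where
  "index_pairs = [(i, j). j \<leftarrow> [0..<4], i \<leftarrow> [0..<j]]"

lemma set_index_pairs: "set index_pairs = {(i, j). i < j \<and> j < 4}"
  by (auto simp: index_pairs_def)

definition pairs_qid :: quasi_identity where
  "pairs_qid =
    (let a = Var; all = Join (Join (a 0) (a 1)) (Join (a 2) (a 3))
     in (map (\<lambda>(i, j). (Meet (a i) (a j), Bot)) index_pairs @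
         map (\<lambda>(i, j). (Star (Star (Join (a i) (a j))), Join (a i) (a j))) index_pairs @
         [(Star all, Bot)], (all, Top)))"

lemma sat_pairs_qid_unfold:
  "sat_qid A pairs_qid \<longleftrightarrow> (\<forall>a :: nat \<Rightarrow> _. range a \<subseteq> carrier A \<longrightarrow>
     (\<forall>j<4. \<forall>i<j. meet A (a i) (a j) = pbot A \<and>
        star A (star A (join A (a i) (a j))) = join A (a i) (a j)) \<longrightarrow>
     star A (join A (join A (a 0) (a 1)) (join A (a 2) (a 3))) = pbot A \<longrightarrow>
     join A (join A (a 0) (a 1)) (join A (a 2) (a 3)) = ptop A)"
proof -
  have prems: "(\<forall>e\<in>set (fst pairs_qid). holds_under A a e) \<longleftrightarrow>
      (\<forall>j<4. \<forall>i<j. meet A (a i) (a j) = pbot A \<and>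
        star A (star A (join A (a i) (a j))) = join A (a i) (a j)) \<and>
      star A (join A (join A (a 0) (a 1)) (join A (a 2) (a 3))) = pbot A" for a
    by (auto simp: pairs_qid_def Let_def holds_under_def ball_Un set_index_pairs)
  have concl: "holds_under A a (snd pairs_qid) \<longleftrightarrow>
      join A (join A (a 0) (a 1)) (join A (a 2) (a 3)) = ptop A" for a
    by (simp add: pairs_qid_def Let_def holds_under_def)
  show ?thesis
    unfolding sat_qid_def prems concl by blast
qed

context p_algebra
begin

lemma star_star_star:
  assumes "x \<in> carrier A"
  shows "star A (star A (star A x)) = star A x"
proof (rule star_unique)
  fix y assume y: "y \<in> carrier A"
  show "meet A y (star A x) = y \<longleftrightarrow> meet A (star A (star A x)) y = pbot A"
  proof
    assume "meet A y (star A x) = y"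
    then have "meet A (star A (star A x)) y = meet A y (meet A (star A x) (star A (star A x)))"
      using assms y by (metis meet_assoc meet_comm star_closed)
    then show "meet A (star A (star A x)) y = pbot A"
      using assms y by (simp add: meet_star meet_bot star_closed)
  next
    assume e: "meet A (star A (star A x)) y = pbot A"
    have le: "meet A x (star A (star A x)) = x"
      using assms by (metis meet_comm meet_star pseudocomplement star_closed)
    have "meet A x y = meet A x (meet A (star A (star A x)) y)"
      using assms y le by (metis meet_assoc star_closed)
    then have "meet A x y = pbot A" using assms e by (simp add: meet_bot)
    then show "meet A y (star A x) = y" using assms y by (simp add: pseudocomplement)
  qed
qed (use assms in \<open>auto intro: star_closed\<close>)

text \<open>
  The hypotheses of \<open>qb3\<close> make the three elements and their binary joins regular, so 0 can serve as
  the fourth element.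
\<close>

lemma sat_qb3_if_pairs:
  assumes sat: "sat_qid A pairs_qid"
  shows "sat_qid A qb3"
  unfolding sat_qb3_unfold
proof (intro ballI impI)
  fix x y z assume c [simp]: "x \<in> carrier A" "y \<in> carrier A" "z \<in> carrier A"
    and e: "join A x y = star A z" "join A x z = star A y" "join A y z = star A x"
  note [simp] = bot_closed top_closed meet_closed join_closed star_closed
  have orth: "meet A x y = pbot A" "meet A x z = pbot A" "meet A y z = pbot A"
    using meet_star[of x] meet_star[of y] e
    by (metis c distrib join_eq_bot join_comm meet_closed)+
  then have orth': "meet A y x = pbot A" "meet A z x = pbot A" "meet A z y = pbot A"
    using meet_comm c by metis+
  note rules = distrib distrib2 orth orth' meet_idem join_idem join_left_idem meet_bot bot_meet
    join_bot bot_join join_assoc join_comm join_left_comm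
  have ss: "star A (star A z) = z" "star A (star A y) = y" "star A (star A x) = x"
    unfolding e[symmetric] by (simp_all add: star_join flip: e) (simp_all add: rules)
  define a where
    "a i = (if i = 0 then x else if i = 1 then y else if i = 2 then z else pbot A)" for i :: nat
  have a: "a 0 = x" "a 1 = y" "a 2 = z" "a 3 = pbot A" "a (Suc 0) = y"
    by (simp_all add: a_def)
  have "star A (join A (join A x y) z) = meet A z (star A z)"
    by (subst star_join) (simp_all add: e ss)
  then have dense: "star A (join A (join A x y) z) = pbot A"
    by (simp add: meet_star)
  have ran: "range a \<subseteq> carrier A" by (auto simp: a_def)
  have prems: "meet A (a i) (a j) = pbot A \<and>
      star A (star A (join A (a i) (a j))) = join A (a i) (a j)" if "j < 4" "i < j" for i j
  proof -
    have "(i, j) \<in> {(0, 1), (0, 2), (1, 2), (0, 3), (1, 3), (2, 3)}"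
      using that by (auto simp: less_Suc_eq numeral_eq_Suc)
    then show ?thesis
      by (auto simp: a orth meet_bot join_bot ss e star_star_star)
  qed
  have "join A (join A (a 0) (a 1)) (join A (a 2) (a 3)) = join A (join A x y) z"
    by (simp only: a join_bot c)
  then show "join A (join A x y) z = ptop A"
    using sat[unfolded sat_pairs_qid_unfold, rule_format, OF ran prems] dense by simp
qed

text \<open>
  If the Stone identity fails at \<open>x\<close>, then \<open>star A x\<close> and \<open>star A (star A x)\<close> are disjoint,
  pseudocomplements of each other and join to less than 1: they are the atoms of a copy of \<open>Bbar 2\<close>.
\<close>

lemma not_Stone_embeds_Bbar2:
  assumes x: "x \<in> carrier A" and ns: "join A (star A x) (star A (star A x)) \<noteq> ptop A"
  shows "embeds (Bbar 2) A"
proof -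
  note [simp] = bot_closed top_closed meet_closed join_closed star_closed
  define c where "c = star A x"
  define d where "d = star A c"
  have [simp]: "c \<in> carrier A" "d \<in> carrier A" using x by (simp_all add: c_def d_def)
  have stars: "star A c = d" "star A d = c" using star_star_star[OF x] by (simp_all add: c_def d_def)
  have ntop: "join A c d \<noteq> ptop A" using ns by (simp add: c_def d_def)
  have orth: "meet A c d = pbot A" using meet_star[of c] by (simp add: d_def)
  then have orth': "meet A d c = pbot A" using meet_comm[of c d] by simp
  have nz: "c \<noteq> pbot A" "d \<noteq> pbot A"
    using ntop stars star_bot by (auto simp: join_top top_join)
  note rules = distrib distrib2 orth orth' meet_idem join_idem join_left_idem meet_bot bot_meet
    join_bot bot_join join_assoc join_comm join_left_comm
  define g where "g S = join A (if 0 \<in> S then c else pbot A) (if 1 \<in> S then d else pbot A)"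
    for S :: "nat set"
  define f where "f a = (case a of None \<Rightarrow> ptop A | Some S \<Rightarrow> g S)" for a
  have gc [simp]: "g S \<in> carrier A" for S by (simp add: g_def)
  have gm: "g (S \<inter> T) = meet A (g S) (g T)" and gj: "g (S \<union> T) = join A (g S) (g T)" for S T
    by (simp_all add: g_def rules)
  have two: "{..<2} = {0, 1 :: nat}" by auto
  have sj: "star A (join A c d) = pbot A" by (simp add: star_join stars orth')
  have gs: "(if S = {} then ptop A else g ({..<2} - S)) = star A (g S)" if "S \<subseteq> {..<2}" for S
  proof -
    have "S = {} \<longleftrightarrow> 0 \<notin> S \<and> 1 \<notin> S" using that unfolding two by auto
    then show ?thesis
      by (simp add: g_def join_bot bot_join star_bot stars sj)
  qed
  have gtop: "g S \<noteq> ptop A" for S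
  proof
    assume "g S = ptop A"
    then have "g (S \<union> {0, 1}) = ptop A" by (simp add: gj top_join del: Un_insert_right)
    then show False using ntop by (simp add: g_def)
  qed
  have memc: "meet A c (g S) = (if 0 \<in> S then c else pbot A)" 
    and memd: "meet A d (g S) = (if 1 \<in> S then d else pbot A)" for S
    by (simp_all add: g_def rules)
  have g_eq: "S = T" if "g S = g T" "S \<subseteq> {..<2}" "T \<subseteq> {..<2}" for S T
  proof -
    have "0 \<in> S \<longleftrightarrow> 0 \<in> T" "1 \<in> S \<longleftrightarrow> 1 \<in> T"
      using memc[of S] memc[of T] memd[of S] memd[of T] nz that(1) by (auto split: if_splits)
    then show ?thesis using that(2,3) unfolding two by blast
  qed
  have "palg_hom (Bbar 2) A f"
    unfolding palg_hom_def
    by (auto simp: Bbar_def f_def gm gj meet_top top_meet join_top top_join star_top gs[symmetric]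
        simp flip: gs) (auto simp: g_def join_bot)
  moreover have "inj_on f (carrier (Bbar 2))"
    by (rule inj_onI) (auto simp: Bbar_def f_def gtop gtop[symmetric] dest!: g_eq)
  ultimately show ?thesis by (auto simp: embeds_def)
qed

text \<open>
  The joins \<open>p\<close> of the first two and \<open>q\<close> of the last two elements are regular, hence complemented.
  Density of \<open>p \<squnion> q\<close> says that \<open>q\<close> lies above the complement of \<open>p\<close>.
\<close>

lemma Stone_sat_pairs_qid:
  assumes Stone: "\<And>x. x \<in> carrier A \<Longrightarrow> join A (star A x) (star A (star A x)) = ptop A"
  shows "sat_qid A pairs_qid"
  unfolding sat_pairs_qid_unfold
proof (intro allI impI)
  note [simp] = bot_closed top_closed meet_closed join_closed star_closed
  fix a :: "nat \<Rightarrow> 'a"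
  assume ran: "range a \<subseteq> carrier A"
    and prems: "\<forall>j<4. \<forall>i<j. meet A (a i) (a j) = pbot A \<and>
        star A (star A (join A (a i) (a j))) = join A (a i) (a j)"
    and dense: "star A (join A (join A (a 0) (a 1)) (join A (a 2) (a 3))) = pbot A"
  define p q where "p = join A (a 0) (a 1)" and "q = join A (a 2) (a 3)"
  have "a i \<in> carrier A" for i using ran by auto
  then have c [simp]: "p \<in> carrier A" "q \<in> carrier A" by (simp_all add: p_def q_def)
  have "star A (star A p) = p" "star A (star A q) = q"
    using prems by (auto simp: p_def q_def)
  then have comp: "join A (star A p) p = ptop A" "join A (star A q) q = ptop A"
    using Stone[of p] Stone[of q] by simp_all
  have dense': "meet A (star A p) (star A q) = pbot A"
    using dense star_join[OF c] by (simp add: p_def q_def)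
  have "meet A (star A p) q = join A (meet A (star A p) (star A q)) (meet A (star A p) q)"
    by (simp add: dense' bot_join)
  also have "\<dots> = star A p" by (simp add: comp meet_top flip: distrib)
  finally have le: "meet A (star A p) q = star A p" .
  have "join A q (star A p) = q"
    by (metis c(1,2) join_absorb le meet_comm star_closed)
  then have "join A p q = join A (join A (star A p) p) q"
    by (metis c join_assoc join_comm star_closed)
  then have "join A p q = ptop A" by (simp add: comp top_join)
  then show "join A (join A (a 0) (a 1)) (join A (a 2) (a 3)) = ptop A"
    by (simp only: p_def q_def)
qed

end

text \<open>
  The dichotomy is on the variety, not on the algebra: gluing valuations requires the target
  \<open>Bbar 2\<close> in the variety, while its absence forces the Stone identity.
\<close>

lemma free_alg_sat_pairs_qid: "sat_qid (free_alg (Mod_id E) X) pairs_qid"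
proof -
  define F where "F = free_alg (Mod_id E) X"
  have FE: "F \<in> Mod_id E" using free_alg_in_variety by (simp add: F_def)
  then interpret p_algebra F by (simp add: Mod_id_def)
  have "sat_qid F pairs_qid"
  proof (cases "Bbar 2 \<in> Mod_id E")
    case False
    have "join F (star F x) (star F (star F x)) = ptop F" if "x \<in> carrier F" for x
    proof (rule ccontr)
      assume "join F (star F x) (star F (star F x)) \<noteq> ptop F"
      then have "embeds (Bbar 2) F" using not_Stone_embeds_Bbar2 that by blast
      then show False
        using Mod_id_embedding[OF closed_alg_p_algebra[OF p_algebra_Bbar]] FE False
        unfolding embeds_def by blast
    qed
    then show ?thesis by (rule Stone_sat_pairs_qid)
  next
    case True
    show ?thesis
      unfolding sat_pairs_qid_unfold
    proof (intro allI impI)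
      fix a :: "nat \<Rightarrow> _"
      assume ran: "range a \<subseteq> carrier F"
        and prems: "\<forall>j<4. \<forall>i<j. meet F (a i) (a j) = pbot F \<and>
            star F (star F (join F (a i) (a j))) = join F (a i) (a j)"
        and dense: "star F (join F (join F (a 0) (a 1)) (join F (a 2) (a 3))) = pbot F"
      have c: "a i \<in> carrier F" for i using ran by auto
      have zero: "a i = pbot F \<or> a j = pbot F" if "i < j" "j < 4" for i j
        using free_alg_disjoint_join[OF True, of "a i" X "a j"] prems c that by (simp add: F_def)
      have reg: "star F (star F (join F (a 0) (a 1))) = join F (a 0) (a 1)"
        "star F (star F (join F (a 2) (a 3))) = join F (a 2) (a 3)"
        using prems by simp_all
      let ?J = "join F (join F (a 0) (a 1)) (join F (a 2) (a 3))"
      consider "a 0 = pbot F" "a 1 = pbot F" | "a 2 = pbot F" "a 3 = pbot F"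
        using zero[of 0 2] zero[of 0 3] zero[of 1 2] zero[of 1 3] by auto
      then have "star F (star F ?J) = ?J"
        by cases (use reg c in \<open>simp_all add: join_bot bot_join join_closed bot_closed\<close>)
      then show "?J = ptop F" using dense by (simp add: star_bot)
    qed
  qed
  then show ?thesis by (simp add: F_def)
qed

section \<open>The algebra of the triples of four points\<close>

text \<open>
  The down-sets of the poset on \<open>{..<8}\<close> whose minimal points are \<open>0, \<dots>, 3\<close> and where \<open>4 + i\<close> lies
  above the three minimal points different from \<open>i\<close>. The pseudocomplement of \<open>D\<close> consists of the points with
  no minimal point of \<open>D\<close> below or equal to them.
\<close>

definition triples :: "nat set palg" where
  "triples = \<lparr>carrier = {D. D \<subseteq> {..<8} \<and> (\<forall>i<4. 4 + i \<in> D \<longrightarrow> {..<4} - {i} \<subseteq> D)},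
     meet = (\<inter>), join = (\<union>),
     star = (\<lambda>D. {i. i < 4 \<and> i \<notin> D} \<union> {4 + i | i. i < 4 \<and> D \<inter> ({..<4} - {i}) = {}}),
     pbot = {}, ptop = {..<8}\<rparr>"

lemma mem_star_triples:
  assumes "i < 4"
  shows "i \<in> star triples D \<longleftrightarrow> i \<notin> D"
    and "4 + i \<in> star triples D \<longleftrightarrow> D \<inter> ({..<4} - {i}) = {}"
  using assms by (auto simp: triples_def)

lemma closed_triples: "closed_alg triples"
  by (auto simp: closed_alg_def triples_def)

text \<open>
  Restricting down-sets to the points below or equal to \<open>4 + i\<close>, which form the dual poset of
  \<open>Bbar 3\<close>.
\<close>

lemma triples_hom_Bbar3:
  assumes i: "i < 4"
  obtains h where "palg_hom triples (Bbar 3) h"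
    "\<And>D. h D = None \<longleftrightarrow> 4 + i \<in> D"
    "\<And>D D'. h D = h D' \<Longrightarrow> h D \<noteq> None \<Longrightarrow> D \<inter> ({..<4} - {i}) = D' \<inter> ({..<4} - {i})"
proof -
  define M where "M = {..<4} - {i}"
  have "card M = card {..<3::nat}" using i by (simp add: M_def)
  then obtain e where e: "bij_betw e M {..<3::nat}"
    using finite_same_card_bij[of M "{..<3::nat}"] by (auto simp: M_def)
  then have inj: "inj_on e M" and img: "e ` M = {..<3}" by (auto simp: bij_betw_def)
  have inj': "e ` (C \<inter> M) = e ` (D \<inter> M) \<longleftrightarrow> C \<inter> M = D \<inter> M" for C D
    using inj by (intro inj_on_image_eq_iff) auto
  define h where "h D = (if 4 + i \<in> D then None else Some (e ` (D \<inter> M)))" for D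
  have full: "C \<inter> M = M" if "C \<in> carrier triples" "4 + i \<in> C" for C
    using that i by (auto simp: triples_def M_def)
  have hM: "h C \<in> carrier (Bbar 3)" for C
    using img by (auto simp: h_def Bbar_def)
  have "palg_hom triples (Bbar 3) h"
    unfolding palg_hom_def
  proof (intro conjI ballI)
    show "h ` carrier triples \<subseteq> carrier (Bbar 3)" using hM by blast
    show "h (pbot triples) = pbot (Bbar 3)" "h (ptop triples) = ptop (Bbar 3)"
      using i by (simp_all add: h_def triples_def Bbar_def)
    fix C assume C: "C \<in> carrier triples"
    show "h (star triples C) = star (Bbar 3) (h C)"
    proof -
      have "star triples C \<inter> M = M - C \<inter> M"
        using mem_star_triples(1)[of _ C] by (auto simp: M_def)
      moreover have "e ` (M - C \<inter> M) = {..<3} - e ` (C \<inter> M)"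
        using inj_on_image_set_diff[OF inj, of M "C \<inter> M"] img by simp
      moreover have "4 + i \<in> star triples C \<longleftrightarrow> C \<inter> M = {}"
        using mem_star_triples(2)[OF i] by (simp add: M_def)
      moreover have "M \<noteq> {}" using img unfolding lt3 by auto
      ultimately show ?thesis
        using full[OF C] by (auto simp: h_def Bbar_def)
    qed
    fix D assume D: "D \<in> carrier triples"
    have "e ` (C \<inter> D \<inter> M) = e ` (C \<inter> M) \<inter> e ` (D \<inter> M)"
      using inj by (auto simp: inj_on_def)
    moreover have "e ` (C \<inter> M) \<inter> e ` M = e ` (C \<inter> M)" "e ` M \<inter> e ` (D \<inter> M) = e ` (D \<inter> M)" by auto
    ultimately show "h (meet triples C D) = meet (Bbar 3) (h C) (h D)"
      using full[OF C] full[OF D] by (simp add: h_def Bbar_def triples_def)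
    show "h (join triples C D) = join (Bbar 3) (h C) (h D)"
      by (auto simp: h_def Bbar_def triples_def)
  qed
  moreover have "h D = None \<longleftrightarrow> 4 + i \<in> D" for D by (simp add: h_def)
  moreover have "D \<inter> M = D' \<inter> M" if "h D = h D'" "h D \<noteq> None" for D D'
    using that inj'[of D D'] by (auto simp: h_def split: if_splits)
  ultimately show ?thesis using that unfolding M_def by blast
qed

lemma Pa_eq_Mod_id: "Pa n = Mod_id {e. sat_id (Bbar n) e}"
proof (rule antisym)
  have "{Bbar n} \<subseteq> Mod_id {e. sat_id (Bbar n) e}"
    by (simp add: Mod_id_def p_algebra_Bbar)
  then show "Pa n \<subseteq> Mod_id {e. sat_id (Bbar n) e}"
    unfolding Pa_def variety_of_def by blast
  show "Mod_id {e. sat_id (Bbar n) e} \<subseteq> Pa n"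
    unfolding Pa_def variety_of_def by (auto simp: Mod_id_def)
qed

lemma triples_in_Pa3: "triples \<in> Mod_id {e. sat_id (Bbar 3) e}"
proof (rule Mod_id_if_separated[OF closed_triples, where ?'b = "nat set option"])
  have B3: "Bbar 3 \<in> Mod_id {e. sat_id (Bbar 3) e}"
    using p_algebra_Bbar by (simp add: Mod_id_def)
  fix C D assume C: "C \<in> carrier triples" and D: "D \<in> carrier triples" and "C \<noteq> D"
  then obtain k where k: "k \<in> C \<longleftrightarrow> k \<notin> D" by blast
  then have k8: "k < 8" using C D by (auto simp: triples_def)
  have "\<exists>h. palg_hom triples (Bbar 3) h \<and> h C \<noteq> h D"
  proof (cases "k < 4")
    case True
    obtain i where i: "i < 4" "i \<noteq> k"
    proof
      show "(if k = 0 then 1 else 0) < (4::nat)" "(if k = 0 then 1 else 0) \<noteq> k" by auto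
    qed
    obtain h where h: "palg_hom triples (Bbar 3) h"
      "\<And>D. h D = None \<longleftrightarrow> 4 + i \<in> D"
      "\<And>D D'. h D = h D' \<Longrightarrow> h D \<noteq> None \<Longrightarrow> D \<inter> ({..<4} - {i}) = D' \<inter> ({..<4} - {i})"
      using triples_hom_Bbar3[OF i(1)] by blast
    have kM: "k \<in> {..<4} - {i}" using True i by simp
    have "h C \<noteq> h D"
    proof
      assume eq: "h C = h D"
      show False
      proof (cases "h C = None")
        case True
        then have "4 + i \<in> C" "4 + i \<in> D" using h(2) eq by metis+
        then have "{..<4} - {i} \<subseteq> C" "{..<4} - {i} \<subseteq> D" using C D i(1) by (auto simp: triples_def)
        then show False using k kM by blast
      next
        case False
        then show False using h(3)[OF eq] k kM by blast
      qed
    qed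
    with h(1) show ?thesis by blast
  next
    case False
    then have i: "k - 4 < 4" "k = 4 + (k - 4)" using k8 by auto
    then show ?thesis using triples_hom_Bbar3[OF i(1)] k by metis
  qed
  with B3 show "\<exists>B\<in>Mod_id {e. sat_id (Bbar 3) e}. \<exists>h :: _ \<Rightarrow> nat set option.
      palg_hom triples B h \<and> h C \<noteq> h D" by blast
qed

text \<open>
  The four atoms refute the quasi-identity: no triple is contained in a pair of minimal points, so the
  set of the two points is its own double pseudocomplement, but the join of all atoms omits the maximal
  points.
\<close>

lemma triples_not_sat_pairs_qid: "\<not> sat_qid triples pairs_qid"
proof
  assume sat: "sat_qid triples pairs_qid"
  define a :: "nat \<Rightarrow> nat set" where "a i = (if i < 4 then {i} else {})" for i
  have ran: "range a \<subseteq> carrier triples"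
    by (auto simp: a_def triples_def)
  have meets: "D \<inter> ({..<4} - {i}) \<noteq> {}" if "p \<noteq> q" "p < 4" "q < 4" "{p, q} \<subseteq> D" for D and i p q :: nat
    using that by (cases "p = i") auto
  have star_eq: "star triples D = {..<4} - D" if "p \<noteq> q" "p < 4" "q < 4" "{p, q} \<subseteq> D" for D p q
    using meets[OF that] by (auto simp: triples_def)
  have prems: "meet triples (a i) (a j) = pbot triples \<and>
      star triples (star triples (join triples (a i) (a j))) = join triples (a i) (a j)"
    if "j < 4" "i < j" for i j
  proof -
    have ij: "join triples (a i) (a j) = {i, j}"
      using that by (auto simp: a_def triples_def)
    have "card ({..<4} - {i, j}) = 2"
      using that by (subst card_Diff_subset) auto
    then obtain p q where pq: "p \<noteq> q" "{..<4} - {i, j} = {p, q}"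
      unfolding card_2_iff by blast
    then have "p < 4" "q < 4" by auto
    then have "star triples (star triples {i, j}) = {..<4} - ({..<4} - {i, j})"
      using that pq star_eq[of i j "{i, j}"] star_eq[of p q "{p, q}"] by simp
    also have "\<dots> = {i, j}" using that by auto
    finally show ?thesis using that ij by (simp add: a_def triples_def)
  qed
  have J: "join triples (join triples (a 0) (a 1)) (join triples (a 2) (a 3)) = {..<4}"
    by (auto simp: triples_def a_def)
  have "star triples {..<4} = pbot triples"
    using star_eq[of 0 1 "{..<4}"] by (simp add: triples_def)
  then have "{..<4} = ptop triples"
    using sat[unfolded sat_pairs_qid_unfold, rule_format, OF ran prems] unfolding J by blast
  then show False by (simp add: triples_def)
qed

lemma triples_sat_qb3: "sat_qid triples qb3"
  unfolding sat_qb3_unfold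
proof (intro ballI impI)
  fix x y z assume c: "x \<in> carrier triples" "y \<in> carrier triples" "z \<in> carrier triples"
    and e: "join triples x y = star triples z" "join triples x z = star triples y"
      "join triples y z = star triples x"
  have U: "join triples C D = C \<union> D" for C D by (simp add: triples_def)
  note e' = e[unfolded U]
  have mono: "j \<in> C" if "C \<in> carrier triples" "4 + i \<in> C" "i < 4" "j < 4" "j \<noteq> i" for C i j
    using that by (auto simp: triples_def)
  \<comment> \<open>Exactly one of the colours \<open>x\<close>, \<open>y\<close>, \<open>z\<close> contains a given minimal point.\<close>
  have cover: "j \<in> x \<or> j \<in> y \<or> j \<in> z"
    and disj: "\<not> (j \<in> x \<and> j \<in> y)" "\<not> (j \<in> x \<and> j \<in> z)" "\<not> (j \<in> y \<and> j \<in> z)"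
    if "j < 4" for j
    using mem_star_triples(1)[OF that] e' by blast+
  \<comment> \<open>A triple that avoids one of the three colours is monochromatic.\<close>
  have two_coloured: "P \<inter> ({..<4} - {i}) = {} \<or> Q \<inter> ({..<4} - {i}) = {}"
    if i: "i < 4" and R: "star triples R = P \<union> Q" "R \<inter> ({..<4} - {i}) = {}"
      and P: "P \<in> carrier triples" and Q: "Q \<in> carrier triples"
      and PQ: "\<And>j. j < 4 \<Longrightarrow> \<not> (j \<in> P \<and> j \<in> Q)" for P Q R i
  proof -
    have "4 + i \<in> P \<union> Q"
      using mem_star_triples(2)[OF i, of R] R by simp
    then have "{..<4} - {i} \<subseteq> P \<or> {..<4} - {i} \<subseteq> Q"
      using mono[OF P _ i] mono[OF Q _ i] by blast
    moreover have "P \<inter> Q \<inter> {..<4} = {}" using PQ by blast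
    ultimately show ?thesis by blast
  qed
  have above: "4 + i \<in> x \<union> y \<union> z" if i: "i < 4" for i
  proof (rule ccontr)
    assume out: "4 + i \<notin> x \<union> y \<union> z"
    have "z \<inter> ({..<4} - {i}) \<noteq> {}" "y \<inter> ({..<4} - {i}) \<noteq> {}" "x \<inter> ({..<4} - {i}) \<noteq> {}"
      using mem_star_triples(2)[OF i] e' out by blast+
    then obtain p q r where p: "p \<in> x" "p < 4" "p \<noteq> i" and q: "q \<in> y" "q < 4" "q \<noteq> i"
      and r: "r \<in> z" "r < 4" "r \<noteq> i" by blast
    have ne: "p \<noteq> q" "p \<noteq> r" "q \<noteq> r" using disj[OF p(2)] disj[OF q(2)] p(1) q(1) r(1) by blast+
    have all: "{..<4} = {i, p, q, r}"
      by (rule card_subset_eq[symmetric]) (use p q r ne i in auto)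
    \<comment> \<open>The fourth point \<open>i\<close> repeats a colour. Omitting a point of another colour from the four points
      leaves a triple with exactly two colours.\<close>
    consider "i \<in> x" | "i \<in> y" | "i \<in> z" using cover[OF i] by blast
    then show False
    proof cases
      case 1
      have "i \<notin> y" "p \<notin> y" "r \<notin> y" using 1 disj[OF i] disj[OF p(2)] disj[OF r(2)] p(1) r(1) by blast+
      then have "y \<inter> ({..<4} - {q}) = {}" unfolding all by blast
      from two_coloured[OF q(2) e'(2)[symmetric] this c(1,3) disj(2)] show False
        using 1 i q r ne by blast
    next
      case 2
      have "i \<notin> x" "q \<notin> x" "r \<notin> x" using 2 disj[OF i] disj[OF q(2)] disj[OF r(2)] q(1) r(1) by blast+
      then have "x \<inter> ({..<4} - {p}) = {}" unfolding all by blast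
      from two_coloured[OF p(2) e'(3)[symmetric] this c(2,3) disj(3)] show False
        using 2 i p r ne by blast
    next
      case 3
      have "i \<notin> x" "q \<notin> x" "r \<notin> x" using 3 disj[OF i] disj[OF q(2)] disj[OF r(2)] q(1) r(1) by blast+
      then have "x \<inter> ({..<4} - {p}) = {}" unfolding all by blast
      from two_coloured[OF p(2) e'(3)[symmetric] this c(2,3) disj(3)] show False
        using 3 i p q ne by blast
    qed
  qed
  have below: "j \<in> x \<union> y \<union> z" if "j < 4" for j using cover[OF that] by blast
  have "k \<in> x \<union> y \<union> z" if "k < 8" for k
  proof (cases "k < 4")
    case False
    then have "k - 4 < 4" "4 + (k - 4) = k" using that by auto
    then show ?thesis using above[of "k - 4"] by simp
  qed (use below in blast)
  then have "{..<8} \<subseteq> x \<union> y \<union> z" by blast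
  then show "join triples (join triples x y) z = ptop triples"
    using c by (auto simp: triples_def)
qed

section \<open>The quasivarieties generated by free algebras\<close>

lemma triples_copy:
  obtains B :: "('u :: infinite) palg" where "B \<in> Pa3_minus" "\<not> sat_qid B pairs_qid"
proof -
  have "finite (carrier triples)"
    by (rule finite_subset[of _ "Pow {..<8}"]) (auto simp: triples_def)
  then obtain B :: "'u palg" and f g where B: "closed_alg B" "palg_hom triples B f"
    "inj_on f (carrier triples)" "palg_hom B triples g" "inj_on g (carrier B)"
    using finite_alg_copy[OF closed_triples] by blast
  have "B \<in> Pa 3"
    unfolding Pa_eq_Mod_id by (rule Mod_id_embedding[OF B(1,4,5) triples_in_Pa3])
  moreover from this have "p_algebra B" by (simp add: Pa_eq_Mod_id Mod_id_def)
  moreover have "sat_qid B qb3" by (rule sat_qid_embedding[OF B(1,4,5) triples_sat_qb3])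
  moreover have "\<not> sat_qid B pairs_qid"
    using sat_qid_embedding[OF closed_triples B(2,3)] triples_not_sat_pairs_qid by blast
  ultimately show ?thesis using that[of B] by (simp add: Pa3_minus_def Mod_qid_def)
qed

lemma quasivariety_of_sat:
  assumes "B \<in> quasivariety_of K" "\<And>A. A \<in> K \<Longrightarrow> p_algebra A \<and> sat_qid A q"
  shows "sat_qid B q"
proof -
  have "K \<subseteq> Mod_qid {q}" using assms(2) by (auto simp: Mod_qid_def)
  then have "B \<in> Mod_qid {q}" using assms(1) unfolding quasivariety_of_def by blast
  then show ?thesis by (simp add: Mod_qid_def)
qed

lemma quasivariety_of_p_algebra:
  assumes "B \<in> quasivariety_of K" "\<And>A. A \<in> K \<Longrightarrow> p_algebra A"
  shows "p_algebra B"
proof -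
  have "K \<subseteq> Mod_qid {}" using assms(2) by (auto simp: Mod_qid_def)
  then have "B \<in> Mod_qid {}" using assms(1) unfolding quasivariety_of_def by blast
  then show ?thesis by (simp add: Mod_qid_def)
qed

lemma sat_qid_no_premises: "sat_qid A ([], e) \<longleftrightarrow> sat_id A e"
  by (simp add: sat_qid_def sat_id_def)

theorem theorem4:
  shows "(\<forall>X :: 'x set.
            (quasivariety_of {free_Pa 3 X} :: ('u :: infinite) palg set) \<subset> Pa3_minus) \<and>
         \<not> (\<exists>K :: 'k palg set. (\<forall>A\<in>K. free_p_algebra A) \<and>
              (quasivariety_of K :: ('u :: infinite) palg set) = Mod_qid {qb3})"
proof -
  obtain B :: "'u palg" where B: "B \<in> Pa3_minus" "\<not> sat_qid B pairs_qid"
    using triples_copy by blast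
  show ?thesis
  proof (intro conjI allI notI)
    fix X :: "'x set"
    let ?F = "free_Pa 3 X"
    have F: "?F = free_alg (Mod_id {e. sat_id (Bbar 3) e}) X"
      by (simp add: free_Pa_def Pa_eq_Mod_id)
    have FM: "?F \<in> Mod_id {e. sat_id (Bbar 3) e}" unfolding F by (rule free_alg_in_variety)
    then have pF: "p_algebra ?F" by (simp add: Mod_id_def)
    have Fq: "sat_qid ?F pairs_qid" unfolding F by (rule free_alg_sat_pairs_qid)
    have "quasivariety_of {?F} \<subseteq> (Pa3_minus :: 'u palg set)"
    proof
      fix A :: "'u palg" assume A: "A \<in> quasivariety_of {?F}"
      have p: "p_algebra A" using quasivariety_of_p_algebra[OF A] pF by simp
      moreover have "sat_id A e" if "sat_id (Bbar 3) e" for e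
      proof -
        have "sat_id ?F e" using FM that unfolding Mod_id_def by blast
        then show ?thesis
          using quasivariety_of_sat[OF A, of "([], e)"] pF by (simp add: sat_qid_no_premises)
      qed
      moreover have "sat_qid A pairs_qid" using quasivariety_of_sat[OF A] pF Fq by simp
      then have "sat_qid A qb3" by (rule p_algebra.sat_qb3_if_pairs[OF p])
      ultimately show "A \<in> Pa3_minus"
        by (simp add: Pa3_minus_def Pa_eq_Mod_id Mod_id_def Mod_qid_def)
    qed
    moreover have "B \<notin> quasivariety_of {?F}"
      using quasivariety_of_sat[of B "{?F}" pairs_qid] B(2) pF Fq by blast
    ultimately show "quasivariety_of {?F} \<subset> (Pa3_minus :: 'u palg set)" using B(1) by blast
  next
    assume "\<exists>K :: 'k palg set. (\<forall>A\<in>K. free_p_algebra A) \<and>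
      (quasivariety_of K :: 'u palg set) = Mod_qid {qb3}"
    then obtain K :: "'k palg set" where K: "\<And>A. A \<in> K \<Longrightarrow> free_p_algebra A"
      and eq: "(quasivariety_of K :: 'u palg set) = Mod_qid {qb3}" by blast
    have "p_algebra A \<and> sat_qid A pairs_qid" if "A \<in> K" for A
    proof -
      obtain E and X :: "'k set" and f where "p_algebra A" "palg_hom A (free_alg (Mod_id E) X) f"
        "inj_on f (carrier A)"
        using K[OF \<open>A \<in> K\<close>] by (auto simp: free_p_algebra_def isomorphic_def bij_betw_def)
      then show ?thesis
        using sat_qid_embedding[OF closed_alg_p_algebra] free_alg_sat_pairs_qid by blast
    qed
    moreover have "B \<in> quasivariety_of K"
      using B(1) unfolding eq by (simp add: Pa3_minus_def)
    ultimately show False using quasivariety_of_sat B(2) by blast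
  qed
qed

end
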